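(* (i) For every constant $c>0$ there is a function $\varepsilon_c:\mathbb{N}\to\mathbb{R}$ with $\varepsilon_c(M)\to 0$ as $M\to\infty$ such that the following holds: for all $n$ and every Boolean function $f:\{0,1\}^n\to\{0,1\}$, if $f$ can be implemented by a circuit over the basis $\{\oplus,\wedge,1\}$ with multiplicative complexity $M$, where $M\ge c\,n$, then $f$ can be implemented by a circuit over the same basis of total complexity at most $$\left(\tfrac12+\varepsilon_c(M)\right)\frac{M(M+2n)}{\log_2 M}.$$ (ii) This bound is asymptotically optimal: there exist Boolean functions $f_n$ of $n$ variables ($n\to\infty$) whose multiplicative complexities $M_n$ (the minimum number of $\wedge$-gates in a circuit over $\{\oplus,\wedge,1\}$ computing $f_n$) satisfy $M_n=\Omega(n)$, and such that every circuit over $\{\oplus,\wedge,1\}$ computing $f_n$ has total complexity at least $\left(\tfrac12-o(1)\right)\frac{M_n(M_n+2n)}{\log_2 M_n}$.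
   Context: A circuit over the basis $\{\oplus,\wedge,1\}$ on input variables $x_1,\dots,x_n$ is a directed acyclic graph whose sources are the variables and the constant $1$, and whose other nodes (gates) each compute either the XOR ($\oplus$) or the conjunction ($\wedge$) of two previously computed functions; it implements a Boolean function if that function is computed at some node. The multiplicative complexity of a circuit is the number of its $\wedge$-gates; the total complexity of a circuit is the total number of its gates ($\oplus$- and $\wedge$-gates). *)

theory Defs
  imports Complex_Main
begin

text \<open>Circuits over the basis {XOR, AND, 1} on n inputs.
  Node numbering: node 0 is the constant 1, nodes 1..n are the input
  variables x_1..x_n (the list entries 0..n-1 of the input), and the j-th gate
  of the circuit (0-based) is node n+1+j.  Each gate takes two previously
  computed nodes as arguments.\<close>

datatype gate = Xor nat nat | And nat nat

type_synonym circuit = "gate list"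

fun gate_args :: "gate \<Rightarrow> nat \<times> nat" where
  "gate_args (Xor i j) = (i, j)"
| "gate_args (And i j) = (i, j)"

definition wf_circuit :: "nat \<Rightarrow> circuit \<Rightarrow> bool" where
  "wf_circuit n C \<longleftrightarrow>
     (\<forall>j < length C. fst (gate_args (C ! j)) < n + 1 + j \<and> snd (gate_args (C ! j)) < n + 1 + j)"

fun eval_gate :: "bool list \<Rightarrow> gate \<Rightarrow> bool" where
  "eval_gate vs (Xor i j) = (vs ! i \<noteq> vs ! j)"
| "eval_gate vs (And i j) = (vs ! i \<and> vs ! j)"

definition node_values :: "circuit \<Rightarrow> bool list \<Rightarrow> bool list" where
  "node_values C xs = foldl (\<lambda>vs g. vs @ [eval_gate vs g]) (True # xs) C"

definition implements :: "nat \<Rightarrow> circuit \<Rightarrow> (bool list \<Rightarrow> bool) \<Rightarrow> bool" where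
  "implements n C f \<longleftrightarrow>
     (\<exists>k < n + 1 + length C. \<forall>xs. length xs = n \<longrightarrow> node_values C xs ! k = f xs)"

definition is_and :: "gate \<Rightarrow> bool" where
  "is_and g \<longleftrightarrow> (\<exists>i j. g = And i j)"

definition mult_compl :: "circuit \<Rightarrow> nat" where
  "mult_compl C = length (filter is_and C)"

definition total_compl :: "circuit \<Rightarrow> nat" where
  "total_compl C = length C"

definition mult_complexity :: "nat \<Rightarrow> (bool list \<Rightarrow> bool) \<Rightarrow> nat" where
  "mult_complexity n f = (LEAST m. \<exists>C. wf_circuit n C \<and> implements n C f \<and> mult_compl C = m)"

end

theory Submission
  imports Defs "HOL-Library.Z2" "HOL-Library.Function_Algebras"
    "HOL-Combinatorics.Permutations" "HOL-Real_Asymp.Real_Asymp"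
begin

text \<open>
  Upper bound. A circuit with M conjunctions is a sequence of products of two linear forms in the
  sources and the earlier products, so everything reduces to evaluating 2M linear forms given by the
  rows of a staircase matrix with about M (M + 2n) entries. Cut the conjunctions into strips and the
  columns into blocks of width s, slightly below log M, and compute all sums within each block. Inside
  a strip and a block nearly all rows can be matched into pairs of rows that agree on the block, so
  that one addition to an accumulator belonging to the pair serves two rows: a row costs 1/(2s)
  additions per column. The columns that only become available within the strip are added one by one.

  Lower bound. For w = n div 4 there is a family of 2^(w^4 - w^3) functions of n variables that need at
  most w^2 + w conjunctions: w levels of w conjunctions, each argument containing an arbitrary
  combination of all gates of lower levels, all of which can be recovered from the function. Since the
  gates of a circuit with L gates can be labelled in L! ways, only L^((1 + o(1)) L) functions have total
  complexity at most L, so some member of the family is as complex as claimed.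
\<close>

section \<open>Circuits as sets of Boolean functions\<close>

text \<open>The simplifier would otherwise replace the ring operations on bits by bitwise ones, and
  eta-expand sums of functions.\<close>

declare add_bit_eq_xor [simp del] mult_bit_eq_and [simp del]
  plus_fun_apply [simp del] zero_fun_apply [simp del] times_fun_apply [simp del]

text \<open>The leading constant 1/2 must be exact on both sides. Upper bound: strips have to be
  short, of height h = o(M / log M), because the accumulators cost about h^2 per strip and later
  columns are added singly; they have to be long compared with 2^s, because up to 2^s rows per block
  of width s stay unpaired. Lower bound: counting gate lists directly gives about L^(2 L) functions
  and loses a factor 2, which the division by L! restores. With about w^2 conjunctions on 4 w
  variables, n is negligible against M and M^2 / (2 log M) is about w^4 / (4 log w), just what a
  family of 2^(w^4 - w^3) functions forces when log L is about 4 log w. The construction bounds the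
  multiplicative complexity M_n only from above. This suffices for the inequality, since M (M + 2 n)
  / log M grows with M. That M_n is at least linear follows from the upper bound itself: fewer than
  n conjunctions would allow O(n^2) gates, whereas the chosen member needs order n^4 / log
  n.\<close>

type_synonym bfun = "bool list \<Rightarrow> bit"

text \<open>A Boolean function of n variables is represented by its extension by 0 to lists of the
  wrong length, so that equality of functions becomes equality of HOL functions.\<close>

definition bfun_of :: "nat \<Rightarrow> (bool list \<Rightarrow> bool) \<Rightarrow> bfun" where
  "bfun_of n f = (\<lambda>xs. if length xs = n then of_bool (f xs) else 0)"

definition source :: "nat \<Rightarrow> nat \<Rightarrow> bfun" where
  "source n k = bfun_of n (\<lambda>xs. (True # xs) ! k)"

text \<open>\<open>S\<close> collects the functions of all nodes, \<open>k\<close> counts gates and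
  \<open>m\<close> conjunctions. A gate that recomputes a member of \<open>S\<close> still counts,
  so the counts are those of a circuit although gate numbers have disappeared.\<close>

inductive computes :: "nat \<Rightarrow> bfun set \<Rightarrow> nat \<Rightarrow> nat \<Rightarrow> bool" for n where
  computes_source: "computes n (source n ` {..n}) 0 0"
| computes_xor: "computes n S k m \<Longrightarrow> u \<in> S \<Longrightarrow> v \<in> S \<Longrightarrow> computes n (insert (u + v) S) (Suc k) m"
| computes_and: "computes n S k m \<Longrightarrow> u \<in> S \<Longrightarrow> v \<in> S \<Longrightarrow> computes n (insert (u * v) S) (Suc k) (Suc m)"

definition node_fun :: "nat \<Rightarrow> circuit \<Rightarrow> nat \<Rightarrow> bfun" where
  "node_fun n C k = bfun_of n (\<lambda>xs. node_values C xs ! k)"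

definition node_funs :: "nat \<Rightarrow> circuit \<Rightarrow> bfun set" where
  "node_funs n C = node_fun n C ` {..<n + 1 + length C}"

lemma bit_add_self [simp]: "(x::bit) + x = 0"
  by (cases x) (simp_all add: one_add_one)

lemma bfun_add_self [simp]: "(u::'a \<Rightarrow> bit) + u = 0"
  by (rule ext) (simp only: plus_fun_apply zero_fun_apply bit_add_self)

lemma bfun_of_inject:
  "bfun_of n f = bfun_of n g \<longleftrightarrow> (\<forall>xs. length xs = n \<longrightarrow> f xs = g xs)"
  by (auto simp: bfun_of_def fun_eq_iff)

lemma bfun_of_xor: "bfun_of n (\<lambda>xs. f xs = (\<not> g xs)) = bfun_of n f + bfun_of n g"
  by (auto simp: bfun_of_def fun_eq_iff plus_fun_apply)

lemma bfun_of_and: "bfun_of n (\<lambda>xs. f xs \<and> g xs) = bfun_of n f * bfun_of n g"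
  by (auto simp: bfun_of_def fun_eq_iff times_fun_apply)

lemma node_values_Nil [simp]: "node_values [] xs = True # xs"
  by (simp add: node_values_def)

lemma node_values_snoc [simp]:
  "node_values (C @ [g]) xs = node_values C xs @ [eval_gate (node_values C xs) g]"
  by (simp add: node_values_def)

lemma length_node_values [simp]: "length (node_values C xs) = Suc (length xs + length C)"
  by (induction C rule: rev_induct) auto

lemma wf_circuit_Nil [simp]: "wf_circuit n []"
  by (simp add: wf_circuit_def)

lemma wf_circuit_snoc:
  "wf_circuit n (C @ [g]) \<longleftrightarrow>
     wf_circuit n C \<and> fst (gate_args g) < n + 1 + length C \<and> snd (gate_args g) < n + 1 + length C"
  by (auto simp: wf_circuit_def nth_append less_Suc_eq)

lemma node_fun_snoc_old:
  "k < n + 1 + length C \<Longrightarrow> node_fun n (C @ [g]) k = node_fun n C k"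
  by (auto simp: node_fun_def bfun_of_def fun_eq_iff nth_append)

lemma node_fun_snoc_new:
  "node_fun n (C @ [g]) (n + 1 + length C) = bfun_of n (\<lambda>xs. eval_gate (node_values C xs) g)"
  by (auto simp: node_fun_def bfun_of_def fun_eq_iff nth_append)

lemma node_funs_snoc:
  "node_funs n (C @ [g]) = insert (bfun_of n (\<lambda>xs. eval_gate (node_values C xs) g)) (node_funs n C)"
proof -
  have "{..<n + 1 + length (C @ [g])} = insert (n + 1 + length C) {..<n + 1 + length C}"
    by auto
  then have "node_funs n (C @ [g]) =
      insert (node_fun n (C @ [g]) (n + 1 + length C)) (node_fun n (C @ [g]) ` {..<n + 1 + length C})"
    by (simp add: node_funs_def)
  also have "node_fun n (C @ [g]) ` {..<n + 1 + length C} = node_funs n C"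
    unfolding node_funs_def by (rule image_cong) (auto simp: node_fun_snoc_old)
  finally show ?thesis by (simp only: node_fun_snoc_new)
qed

lemma node_funs_Nil: "node_funs n [] = source n ` {..n}"
  by (simp add: node_funs_def node_fun_def source_def lessThan_Suc_atMost)

lemma circuit_computes:
  "wf_circuit n C \<Longrightarrow> computes n (node_funs n C) (length C) (mult_compl C)"
proof (induction C rule: rev_induct)
  case Nil
  then show ?case by (simp add: node_funs_Nil mult_compl_def computes_source)
next
  case (snoc g C)
  then have IH: "computes n (node_funs n C) (length C) (mult_compl C)"
    by (simp add: wf_circuit_snoc)
  show ?case
  proof (cases g)
    case (Xor i j)
    with snoc.prems have "node_fun n C i \<in> node_funs n C" "node_fun n C j \<in> node_funs n C"
      by (auto simp: wf_circuit_snoc node_funs_def)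
    from computes_xor[OF IH this] Xor show ?thesis
      by (simp add: node_funs_snoc bfun_of_xor node_fun_def mult_compl_def is_and_def)
  next
    case (And i j)
    with snoc.prems have "node_fun n C i \<in> node_funs n C" "node_fun n C j \<in> node_funs n C"
      by (auto simp: wf_circuit_snoc node_funs_def)
    from computes_and[OF IH this] And show ?thesis
      by (simp add: node_funs_snoc bfun_of_and node_fun_def mult_compl_def is_and_def)
  qed
qed

lemma computes_circuit:
  assumes "computes n S k m"
  shows "\<exists>C. wf_circuit n C \<and> length C = k \<and> mult_compl C = m \<and> node_funs n C = S"
  using assms
proof (induction rule: computes.induct)
  case computes_source
  show ?case by (rule exI[of _ "[]"]) (simp add: node_funs_Nil mult_compl_def)
next
  case (computes_xor S k m u v)
  then obtain C i j where C: "wf_circuit n C" "length C = k" "mult_compl C = m" "node_funs n C = S"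
    "i < n + 1 + length C" "u = node_fun n C i" "j < n + 1 + length C" "v = node_fun n C j"
    by (auto simp: node_funs_def)
  then show ?case
    by (intro exI[of _ "C @ [Xor i j]"])
      (simp add: wf_circuit_snoc node_funs_snoc bfun_of_xor node_fun_def mult_compl_def is_and_def)
next
  case (computes_and S k m u v)
  then obtain C i j where C: "wf_circuit n C" "length C = k" "mult_compl C = m" "node_funs n C = S"
    "i < n + 1 + length C" "u = node_fun n C i" "j < n + 1 + length C" "v = node_fun n C j"
    by (auto simp: node_funs_def)
  then show ?case
    by (intro exI[of _ "C @ [And i j]"])
      (simp add: wf_circuit_snoc node_funs_snoc bfun_of_and node_fun_def mult_compl_def is_and_def)
qed

lemma implements_iff: "implements n C f \<longleftrightarrow> bfun_of n f \<in> node_funs n C"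
  by (auto simp: implements_def node_funs_def node_fun_def bfun_of_inject image_iff)

lemma circuit_iff_computes:
  "(\<exists>C. wf_circuit n C \<and> implements n C f \<and> mult_compl C = m \<and> total_compl C = k) \<longleftrightarrow>
   (\<exists>S. computes n S k m \<and> bfun_of n f \<in> S)"
  unfolding implements_iff total_compl_def
  by (metis circuit_computes computes_circuit)

lemma computes_pad_and:
  assumes "computes n S k m"
  shows "\<exists>S'. S \<subseteq> S' \<and> computes n S' (k + d) (m + d)"
proof (induction d)
  case 0
  show ?case using assms by auto
next
  case (Suc d)
  then obtain S' where S': "S \<subseteq> S'" "computes n S' (k + d) (m + d)" by blast
  from S'(2) have "\<exists>u. u \<in> S'" by (induction rule: computes.induct) auto
  then obtain u where "u \<in> S'" by blast
  \<comment> \<open>A gate multiplying a function by itself computes nothing new but counts as a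
    conjunction.\<close>
  from computes_and[OF S'(2) this this] S'(1) show ?case
    by (intro exI[of _ "insert (u * u) S'"]) auto
qed

text \<open>Counts become upper bounds and \<open>S\<close> a part of what is computed, so costs can
  be rounded up and auxiliary functions forgotten. The function 0 is always included, so that empty
  sums need no special treatment.\<close>

definition reachable :: "nat \<Rightarrow> nat \<Rightarrow> nat \<Rightarrow> bfun set \<Rightarrow> bool" where
  "reachable n k m S \<longleftrightarrow>
     (\<exists>S' k' m'. computes n S' k' m' \<and> k' \<le> k \<and> m' \<le> m \<and> insert 0 S \<subseteq> S')"

lemma reachable_mono:
  "reachable n k m S \<Longrightarrow> k \<le> k' \<Longrightarrow> m \<le> m' \<Longrightarrow> T \<subseteq> insert 0 S \<Longrightarrow> reachable n k' m' T"
  unfolding reachable_def by (meson insert_subset order.trans subset_insertI)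

lemma reachable_source: "reachable n 1 0 (source n ` {..n})"
proof -
  have "source n 0 \<in> source n ` {..n}" by auto
  \<comment> \<open>One gate pays for the function 0, obtained as 1 + 1.\<close>
  from computes_xor[OF computes_source this this]
  have "computes n (insert 0 (source n ` {..n})) (Suc 0) 0" by (simp del: image_eqI)
  then show ?thesis unfolding reachable_def by auto
qed

lemma reachable_xor:
  assumes "reachable n k m S" "u \<in> insert 0 S" "v \<in> insert 0 S"
  shows "reachable n (Suc k) m (insert (u + v) S)"
proof -
  from assms(1) obtain S' k' m' where S': "computes n S' k' m'" "k' \<le> k" "m' \<le> m" "insert 0 S \<subseteq> S'"
    unfolding reachable_def by blast
  have "computes n (insert (u + v) S') (Suc k') m'"
    using S' assms(2,3) by (intro computes_xor) auto
  with S' show ?thesis unfolding reachable_def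
    by (intro exI[of _ "insert (u + v) S'"] exI[of _ "Suc k'"] exI[of _ m']) auto
qed

lemma reachable_and:
  assumes "reachable n k m S" "u \<in> insert 0 S" "v \<in> insert 0 S"
  shows "reachable n (Suc k) (Suc m) (insert (u * v) S)"
proof -
  from assms(1) obtain S' k' m' where S': "computes n S' k' m'" "k' \<le> k" "m' \<le> m" "insert 0 S \<subseteq> S'"
    unfolding reachable_def by blast
  have "computes n (insert (u * v) S') (Suc k') (Suc m')"
    using S' assms(2,3) by (intro computes_and) auto
  with S' show ?thesis unfolding reachable_def
    by (intro exI[of _ "insert (u * v) S'"] exI[of _ "Suc k'"] exI[of _ "Suc m'"]) auto
qed

lemma reachable_sum:
  assumes "reachable n k m S" "finite A" "v ` A \<subseteq> insert 0 S"
  shows "reachable n (k + card A) m (insert (sum v A) S)"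
  using assms(2,3)
proof (induction A rule: finite_induct)
  case empty
  have "insert (sum v {}) S \<subseteq> insert 0 S" by (subst sum.empty) blast
  then show ?case by (rule reachable_mono[OF assms(1), rotated 2]) simp_all
next
  case (insert a A)
  then have "reachable n (k + card A) m (insert (sum v A) S)" by auto
  then have "reachable n (Suc (k + card A)) m (insert (v a + sum v A) (insert (sum v A) S))"
    using insert.prems by (intro reachable_xor) auto
  then show ?case by (rule reachable_mono) (use insert in auto)
qed

lemma reachable_sums:
  assumes "reachable n k m S" "finite I" "\<And>i. i \<in> I \<Longrightarrow> finite (A i)"
    "\<And>i. i \<in> I \<Longrightarrow> v i ` A i \<subseteq> insert 0 S"
  shows "reachable n (k + (\<Sum>i\<in>I. card (A i))) m (S \<union> (\<lambda>i. sum (v i) (A i)) ` I)"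
  using assms(2,3,4)
proof (induction I rule: finite_induct)
  case empty
  show ?case using assms(1) by auto
next
  case (insert i I)
  then have "reachable n (k + (\<Sum>i\<in>I. card (A i))) m (S \<union> (\<lambda>i. sum (v i) (A i)) ` I)" by auto
  from reachable_sum[OF this, of "A i" "v i"] insert.prems
  have "reachable n (k + (\<Sum>i\<in>I. card (A i)) + card (A i)) m
      (insert (sum (v i) (A i)) (S \<union> (\<lambda>i. sum (v i) (A i)) ` I))" by blast
  then show ?case by (rule reachable_mono) (use insert in auto)
qed

section \<open>The normal form of a circuit with M conjunctions\<close>

lemma sum_add_eq_sum_sym_diff:
  fixes y :: "'a \<Rightarrow> 'b \<Rightarrow> bit"
  assumes "finite A" "finite B"
  shows "sum y A + sum y B = sum y (sym_diff A B)"
proof -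
  have "sum y A = sum y (A \<inter> B) + sum y (A - B)"
    using assms by (intro sum.Int_Diff)
  moreover have "sum y B = sum y (A \<inter> B) + sum y (B - A)"
    using assms sum.Int_Diff[of B y A] by (simp add: Int_commute)
  ultimately have "sum y A + sum y B
      = (sum y (A \<inter> B) + sum y (A \<inter> B)) + (sum y (A - B) + sum y (B - A))"
    by (simp only: ac_simps)
  also have "\<dots> = sum y (A - B) + sum y (B - A)"
    by (simp only: bfun_add_self add_0)
  also have "\<dots> = sum y (sym_diff A B)"
    using assms by (intro sum.union_disjoint[symmetric]) auto
  finally show ?thesis .
qed

lemma sum_fun_upd_notin: "k \<notin> F \<Longrightarrow> sum (y(k := z)) F = sum y F"
  by (rule sum.cong) auto

text \<open>XOR gates need no variable of their own: over the two-element field they only replace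
  two index sets by their symmetric difference. Each AND gate introduces one new variable, whose
  argument sets lie below it.\<close>

lemma computes_normal_form:
  assumes "computes n S k m"
  shows "\<exists>y A B. (\<forall>i\<le>n. y i = source n i) \<and>
    (\<forall>i<m. A i \<subseteq> {..<n+1+i} \<and> B i \<subseteq> {..<n+1+i} \<and> y (n+1+i) = sum y (A i) * sum y (B i)) \<and>
    (\<forall>v\<in>S. \<exists>F\<subseteq>{..<n+1+m}. v = sum y F)"
  using assms
proof (induction rule: computes.induct)
  case computes_source
  have "\<exists>F\<subseteq>{..<n+1+0}. source n i = sum (source n) F" if "i \<le> n" for i
    using that by (intro exI[of _ "{i}"]) auto
  then show ?case by (intro exI[of _ "source n"]) auto
next
  case (computes_xor S k m u v)
  then obtain y A B where y: "\<forall>i\<le>n. y i = source n i"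
    "\<forall>i<m. A i \<subseteq> {..<n+1+i} \<and> B i \<subseteq> {..<n+1+i} \<and> y (n+1+i) = sum y (A i) * sum y (B i)"
    "\<forall>v\<in>S. \<exists>F\<subseteq>{..<n+1+m}. v = sum y F" by blast
  from y(3) computes_xor.hyps obtain F G where "F\<subseteq>{..<n+1+m}" "u = sum y F" "G\<subseteq>{..<n+1+m}" "v = sum y G"
    by metis
  then have "\<exists>F\<subseteq>{..<n+1+m}. u + v = sum y F"
    by (intro exI[of _ "sym_diff F G"]) (auto simp: sum_add_eq_sum_sym_diff finite_subset)
  with y show ?case by (intro exI[of _ y] exI[of _ A] exI[of _ B]) blast
next
  case (computes_and S k m u v)
  then obtain y A B where y: "\<forall>i\<le>n. y i = source n i"
    "\<forall>i<m. A i \<subseteq> {..<n+1+i} \<and> B i \<subseteq> {..<n+1+i} \<and> y (n+1+i) = sum y (A i) * sum y (B i)"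
    "\<forall>v\<in>S. \<exists>F\<subseteq>{..<n+1+m}. v = sum y F" by blast
  from y(3) computes_and.hyps obtain F G where FG: "F\<subseteq>{..<n+1+m}" "u = sum y F" "G\<subseteq>{..<n+1+m}" "v = sum y G"
    by metis
  define y' where "y' = y(n+1+m := u * v)"
  have eq: "sum y' H = sum y H" if "H \<subseteq> {..<n+1+m}" for H
    unfolding y'_def using that by (intro sum_fun_upd_notin) auto
  have "y' i = source n i" if "i \<le> n" for i using that y(1) by (auto simp: y'_def)
  moreover have "(A(m := F)) i \<subseteq> {..<n+1+i} \<and> (B(m := G)) i \<subseteq> {..<n+1+i} \<and>
      y' (n+1+i) = sum y' ((A(m := F)) i) * sum y' ((B(m := G)) i)" if "i < Suc m" for i
  proof (cases "i = m")
    case True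
    have "y' (n+1+m) = sum y' F * sum y' G"
      unfolding eq[OF FG(1)] eq[OF FG(3)] FG(2,4)[symmetric] by (simp add: y'_def)
    with FG(1,3) True show ?thesis by simp
  next
    case False
    with that have i: "i < m" by simp
    have AB: "A i \<subseteq> {..<n+1+i}" "B i \<subseteq> {..<n+1+i}" using y(2) i by blast+
    have "A i \<subseteq> {..<n+1+m}" "B i \<subseteq> {..<n+1+m}" using AB i by force+
    note e = eq[OF this(1)] eq[OF this(2)]
    have "y' (n+1+i) = sum y' (A i) * sum y' (B i)"
      unfolding e using y(2) i by (auto simp: y'_def)
    with AB False show ?thesis by simp
  qed
  moreover have "\<exists>F\<subseteq>{..<n+1+Suc m}. w = sum y' F" if "w \<in> insert (u * v) S" for w
  proof (cases "w = u * v")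
    case True
    then show ?thesis by (intro exI[of _ "{n+1+m}"]) (auto simp: y'_def)
  next
    case False
    with that y(3) obtain H where H: "H \<subseteq> {..<n+1+m}" "w = sum y H" by blast
    then show ?thesis using eq[OF H(1)] by (intro exI[of _ H]) auto
  qed
  ultimately show ?case
    by (intro exI[of _ y'] exI[of _ "A(m := F)"] exI[of _ "B(m := G)"] conjI allI ballI impI) (simp_all only: simp_thms)
qed

text \<open>Padding with gates whose inputs are empty sums makes the sequence of conjunctions infinite,
  so that it can be cut into strips of any length.\<close>

lemma computes_infinite_normal_form:
  assumes "computes n S k m" "v \<in> S"
  obtains y A B F where "\<And>i. i \<le> n \<Longrightarrow> y i = source n i"
    "\<And>i. A i \<subseteq> {..<n+1+i}" "\<And>i. B i \<subseteq> {..<n+1+i}"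
    "\<And>i. y (n+1+i) = sum y (A i) * sum y (B i)"
    "F \<subseteq> {..<n+1+m}" "v = sum y F"
proof -
  from computes_normal_form[OF assms(1)] assms(2) obtain y A B F where y: "\<forall>i\<le>n. y i = source n i"
    "\<forall>i<m. A i \<subseteq> {..<n+1+i} \<and> B i \<subseteq> {..<n+1+i} \<and> y (n+1+i) = sum y (A i) * sum y (B i)"
    and F: "F\<subseteq>{..<n+1+m}" "v = sum y F" by metis
  define y' where "y' = (\<lambda>k. if k < n+1+m then y k else 0)"
  have eq: "sum y' H = sum y H" if "H \<subseteq> {..<n+1+m}" for H
    unfolding y'_def using that by (intro sum.cong) auto
  define A' where "A' = (\<lambda>i. if i < m then A i else {})"
  define B' where "B' = (\<lambda>i. if i < m then B i else {})"
  show ?thesis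
  proof (rule that[of y' A' B' F])
    show "y' i = source n i" if "i \<le> n" for i using that y(1) by (auto simp: y'_def)
    show "A' i \<subseteq> {..<n+1+i}" "B' i \<subseteq> {..<n+1+i}" for i using y(2) by (auto simp: A'_def B'_def)
    show "y' (n+1+i) = sum y' (A' i) * sum y' (B' i)" for i
    proof (cases "i < m")
      case True
      have AB: "A i \<subseteq> {..<n+1+i}" "B i \<subseteq> {..<n+1+i}" using y(2) True by blast+
      have "A i \<subseteq> {..<n+1+m}" "B i \<subseteq> {..<n+1+m}" using AB True by force+
      note e = eq[OF this(1)] eq[OF this(2)]
      have "y' (n+1+i) = sum y' (A i) * sum y' (B i)"
        unfolding e using y(2) True by (auto simp: y'_def)
      with True show ?thesis by (simp add: A'_def B'_def)
    next
      case False
      then have "A' i = {}" "y' (n+1+i) = 0" by (simp_all add: A'_def y'_def)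
      then show ?thesis by (simp only: sum.empty mult_zero_left)
    qed
    show "F \<subseteq> {..<n+1+m}" by fact
    show "v = sum y' F" using F eq by simp
  qed
qed

section \<open>Simultaneous computation of linear forms\<close>

text \<open>As long as \<open>pat\<close> is not injective on the rest, two elements with the same
  value are split off as a pair; once it is injective, at most \<open>card P\<close> elements
  remain.\<close>

lemma pair_up_equal_values:
  assumes "finite R" "finite P" "pat ` R \<subseteq> P"
  shows "\<exists>Q. finite Q \<and> (\<forall>q\<in>Q. \<exists>i j. i \<noteq> j \<and> q = {i, j} \<and> i \<in> R \<and> j \<in> R \<and> pat i = pat j) \<and>
    (\<forall>q\<in>Q. \<forall>q'\<in>Q. q \<noteq> q' \<longrightarrow> q \<inter> q' = {}) \<and> 2 * card Q \<le> card R \<and> card (R - \<Union>Q) \<le> card P"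
  using assms(1,3)
proof (induction "card R" arbitrary: R rule: less_induct)
  case less
  show ?case
  proof (cases "inj_on pat R")
    case True
    then have "card R \<le> card P" using card_inj_on_le less.prems(2) assms(2) by blast
    then show ?thesis by (intro exI[of _ "{}"]) auto
  next
    case False
    then obtain i j where ij: "i \<in> R" "j \<in> R" "i \<noteq> j" "pat i = pat j" by (auto simp: inj_on_def)
    define R' where "R' = R - {i, j}"
    have "card {i, j} \<le> card R" using ij less.prems(1) by (intro card_mono) auto
    moreover have "card R' = card R - card {i, j}"
      unfolding R'_def using ij by (intro card_Diff_subset) auto
    ultimately have "card R = card R' + 2" using ij by simp
    then have "card R' < card R" "finite R'" "pat ` R' \<subseteq> P" using less.prems by (auto simp: R'_def)
    from less.hyps[OF this] obtain Q where Q: "finite Q"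
      "\<forall>q\<in>Q. \<exists>i j. i \<noteq> j \<and> q = {i, j} \<and> i \<in> R' \<and> j \<in> R' \<and> pat i = pat j"
      "\<forall>q\<in>Q. \<forall>q'\<in>Q. q \<noteq> q' \<longrightarrow> q \<inter> q' = {}" "2 * card Q \<le> card R'" "card (R' - \<Union>Q) \<le> card P"
      by blast
    have dis: "q \<inter> {i, j} = {}" if "q \<in> Q" for q using Q(2) that by (fastforce simp: R'_def)
    have "R - \<Union>(insert {i, j} Q) = R' - \<Union>Q" by (auto simp: R'_def)
    moreover have "2 * card (insert {i, j} Q) \<le> card R"
      using Q(4) \<open>card R = card R' + 2\<close> by (simp add: card_insert_if Q(1))
    moreover have "\<forall>q\<in>insert {i, j} Q. \<exists>i j. i \<noteq> j \<and> q = {i, j} \<and> i \<in> R \<and> j \<in> R \<and> pat i = pat j"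
      using ij Q(2) by (auto simp: R'_def) blast+
    moreover have "\<forall>q\<in>insert {i, j} Q. \<forall>q'\<in>insert {i, j} Q. q \<noteq> q' \<longrightarrow> q \<inter> q' = {}"
      using Q(3) dis by (metis inf_commute insert_iff)
    ultimately show ?thesis using Q(1,5) by (intro exI[of _ "insert {i, j} Q"]) simp
  qed
qed

lemma sum_blocks:
  fixes y :: "nat \<Rightarrow> 'b::comm_monoid_add"
  assumes "X \<subseteq> {..<s * b}" "s > 0"
  shows "sum y X = (\<Sum>\<beta><b. sum y (X \<inter> {\<beta> * s..<\<beta> * s + s}))"
proof -
  have "finite X" using assms(1) finite_subset by blast
  have "sum y X = (\<Sum>\<beta><b. sum y {k \<in> X. k div s = \<beta>})"
  proof (rule sum.group[symmetric])
    show "(\<lambda>k. k div s) ` X \<subseteq> {..<b}"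
      using assms by (auto simp: less_mult_imp_div_less mult.commute)
  qed (use \<open>finite X\<close> in auto)
  moreover have "{k \<in> X. k div s = \<beta>} = X \<inter> {\<beta> * s..<\<beta> * s + s}" for \<beta>
  proof -
    have "k div s = \<beta> \<longleftrightarrow> \<beta> * s \<le> k \<and> k < \<beta> * s + s" for k
    proof
      assume "k div s = \<beta>"
      with div_mult_mod_eq[of k s] mod_less_divisor[OF assms(2), of k]
      show "\<beta> * s \<le> k \<and> k < \<beta> * s + s" by auto
    next
      assume "\<beta> * s \<le> k \<and> k < \<beta> * s + s"
      then show "k div s = \<beta>" using div_nat_eqI[of s \<beta> k] by (simp only: mult.commute mult_Suc_right add.commute)
    qed
    then show ?thesis
      by (intro set_eqI) (simp only: mem_Collect_eq Int_iff atLeastLessThan_iff)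
  qed
  ultimately show ?thesis by (simp only:)
qed

text \<open>Nechiporuk's saving of the factor 2: in every block of s columns almost all rows can be paired
  with a row that has the same entries there, and a partial sum of the block is then added once to
  the accumulator of the pair instead of to both rows.\<close>

lemma reachable_rows:
  assumes reach: "reachable n k m S" and R: "finite R" "card R \<le> 2 * h" and s: "s > 0"
    and X: "\<And>\<rho>. \<rho> \<in> R \<Longrightarrow> X \<rho> \<subseteq> {..<s * b}"
    and patterns: "\<And>\<beta> T. \<beta> < b \<Longrightarrow> T \<subseteq> {\<beta> * s..<\<beta> * s + s} \<Longrightarrow> sum y T \<in> insert 0 S"
  shows "reachable n (k + b * h + b * 2 ^ s + 4 * h\<^sup>2) m (S \<union> (\<lambda>\<rho>. sum y (X \<rho>)) ` R)"
proof -
  define pat where "pat = (\<lambda>\<beta> \<rho>. X \<rho> \<inter> {\<beta> * s..<\<beta> * s + s})"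
  define good where "good = (\<lambda>\<beta> Q. finite Q \<and>
    (\<forall>q\<in>Q. \<exists>i j. i \<noteq> j \<and> q = {i, j} \<and> i \<in> R \<and> j \<in> R \<and> pat \<beta> i = pat \<beta> j) \<and>
    (\<forall>q\<in>Q. \<forall>q'\<in>Q. q \<noteq> q' \<longrightarrow> q \<inter> q' = {}) \<and> 2 * card Q \<le> card R \<and>
    card (R - \<Union>Q) \<le> card (Pow {\<beta> * s..<\<beta> * s + s}))"
  have "\<forall>\<beta>. \<exists>Q. good \<beta> Q"
    unfolding good_def by (intro allI pair_up_equal_values R) (auto simp: pat_def)
  then obtain Q where "\<And>\<beta>. good \<beta> (Q \<beta>)" by metis
  then have Q: "\<And>\<beta>. finite (Q \<beta>)"
    "\<And>\<beta> q. q \<in> Q \<beta> \<Longrightarrow> \<exists>i j. i \<noteq> j \<and> q = {i, j} \<and> i \<in> R \<and> j \<in> R \<and> pat \<beta> i = pat \<beta> j"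
    "\<And>\<beta> q q'. q \<in> Q \<beta> \<Longrightarrow> q' \<in> Q \<beta> \<Longrightarrow> q \<noteq> q' \<Longrightarrow> q \<inter> q' = {}"
    "\<And>\<beta>. 2 * card (Q \<beta>) \<le> card R" "\<And>\<beta>. card (R - \<Union>(Q \<beta>)) \<le> card (Pow {\<beta> * s..<\<beta> * s + s})"
    unfolding good_def by blast+
  define U where "U = (\<lambda>\<beta>. R - \<Union>(Q \<beta>))"
  define pairs where "pairs = (\<Union>\<beta><b. Q \<beta>)"
  have fin_pairs: "finite pairs" by (simp add: pairs_def Q(1))
  define rep where "rep = (\<lambda>q::'a set. SOME \<rho>. \<rho> \<in> q)"
  have rep: "pat \<beta> (rep q) = pat \<beta> \<rho>" if "q \<in> Q \<beta>" "\<rho> \<in> q" for \<beta> q \<rho>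
  proof -
    have "rep q \<in> q" unfolding rep_def using that(2) by (rule someI)
    moreover from Q(2)[OF that(1)] obtain i j where "q = {i, j}" "pat \<beta> i = pat \<beta> j" by blast
    ultimately show ?thesis using that(2) by (metis insertE singletonD)
  qed
  \<comment> \<open>The accumulator of a pair collects the contributions of all blocks in which the
    pair occurs. A row adds it only once, however many blocks it serves, which makes the cost of
    these additions independent of \<open>b\<close>.\<close>
  define u where "u = (\<lambda>q. \<Sum>\<beta>\<in>{\<beta>\<in>{..<b}. q \<in> Q \<beta>}. sum y (pat \<beta> (rep q)))"
  have pats: "sum y (pat \<beta> \<rho>) \<in> insert 0 S" if "\<beta> < b" for \<beta> \<rho>
    using that by (intro patterns) (auto simp: pat_def)

  \<comment> \<open>Double counting: a block contributes at most \<open>h\<close> pairs, since they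
    are disjoint pairs of at most \<open>2 * h\<close> rows.\<close>
  have cost_pairs: "(\<Sum>q\<in>pairs. card {\<beta>\<in>{..<b}. q \<in> Q \<beta>}) \<le> b * h"
  proof -
    have "(\<Sum>q\<in>pairs. card {\<beta>\<in>{..<b}. q \<in> Q \<beta>}) = (\<Sum>\<beta><b. card {q\<in>pairs. q \<in> Q \<beta>})"
      using sum.swap_restrict[OF fin_pairs finite_lessThan, where g = "\<lambda>_ _. 1::nat" and R = "\<lambda>q \<beta>. q \<in> Q \<beta>"] by simp
    also have "\<dots> = (\<Sum>\<beta><b. card (Q \<beta>))"
      by (intro sum.cong refl arg_cong[where f = card]) (auto simp: pairs_def)
    also have "\<dots> \<le> (\<Sum>\<beta><b. h)"
    proof (rule sum_mono)
      show "card (Q \<beta>) \<le> h" for \<beta> using Q(4)[of \<beta>] R(2) by linarith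
    qed
    finally show ?thesis by simp
  qed
  have "reachable n (k + (\<Sum>q\<in>pairs. card {\<beta>\<in>{..<b}. q \<in> Q \<beta>})) m (S \<union> u ` pairs)"
    unfolding u_def by (rule reachable_sums[OF reach fin_pairs]) (use pats in auto)
  then have reach1: "reachable n (k + b * h) m (S \<union> u ` pairs)"
    by (rule reachable_mono) (use cost_pairs in auto)

  \<comment> \<open>A row is the sum of the accumulators of its pairs and, for each block where it
    is unpaired, of its own block sum.\<close>
  define terms where "terms = (\<lambda>\<rho>. {q\<in>pairs. \<rho> \<in> q} <+> {\<beta>\<in>{..<b}. \<rho> \<in> U \<beta>})"
  define val where "val = (\<lambda>\<rho>. case_sum u (\<lambda>\<beta>. sum y (pat \<beta> \<rho>)))"
  have row: "sum (val \<rho>) (terms \<rho>) = sum y (X \<rho>)" if "\<rho> \<in> R" for \<rho>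
  proof -
    have "sum (val \<rho>) (terms \<rho>) =
        (\<Sum>q\<in>{q\<in>pairs. \<rho> \<in> q}. u q) + (\<Sum>\<beta>\<in>{\<beta>\<in>{..<b}. \<rho> \<in> U \<beta>}. sum y (pat \<beta> \<rho>))"
      unfolding terms_def val_def using fin_pairs by (subst sum.Plus) auto
    \<comment> \<open>After exchanging the sums, a block in which the row is paired contributes
      exactly once, because the pairs of one block are disjoint.\<close>
    also have "(\<Sum>q\<in>{q\<in>pairs. \<rho> \<in> q}. u q) =
        (\<Sum>\<beta><b. \<Sum>q\<in>{q\<in>{q\<in>pairs. \<rho> \<in> q}. q \<in> Q \<beta>}. sum y (pat \<beta> (rep q)))"
      unfolding u_def using fin_pairs by (intro sum.swap_restrict) auto
    also have "\<dots> = (\<Sum>\<beta><b. if \<rho> \<in> U \<beta> then 0 else sum y (pat \<beta> \<rho>))"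
    proof (rule sum.cong[OF refl])
      fix \<beta> assume \<beta>: "\<beta> \<in> {..<b}"
      show "(\<Sum>q\<in>{q\<in>{q\<in>pairs. \<rho> \<in> q}. q \<in> Q \<beta>}. sum y (pat \<beta> (rep q))) =
          (if \<rho> \<in> U \<beta> then 0 else sum y (pat \<beta> \<rho>))"
      proof (cases "\<rho> \<in> U \<beta>")
        case True
        then have "{q\<in>{q\<in>pairs. \<rho> \<in> q}. q \<in> Q \<beta>} = {}" by (auto simp: U_def)
        then show ?thesis using True by (simp only: sum.empty if_True)
      next
        case False
        with that obtain q where q: "q \<in> Q \<beta>" "\<rho> \<in> q" by (auto simp: U_def)
        then have "{q\<in>{q\<in>pairs. \<rho> \<in> q}. q \<in> Q \<beta>} = {q}"
          using Q(3)[of _ \<beta> q] \<beta> by (auto simp: pairs_def)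
        then show ?thesis using False rep[OF q] by simp
      qed
    qed
    also have "\<dots> + (\<Sum>\<beta>\<in>{\<beta>\<in>{..<b}. \<rho> \<in> U \<beta>}. sum y (pat \<beta> \<rho>)) =
       (\<Sum>\<beta><b. (if \<rho> \<in> U \<beta> then 0 else sum y (pat \<beta> \<rho>)) + (if \<rho> \<in> U \<beta> then sum y (pat \<beta> \<rho>) else 0))"
      by (subst sum.inter_filter) (auto simp only: sum.distrib finite_lessThan)
    also have "\<dots> = (\<Sum>\<beta><b. sum y (pat \<beta> \<rho>))"
      by (intro sum.cong refl) (simp only: add_0 add_0_right split: if_split, simp)
    also have "\<dots> = sum y (X \<rho>)" unfolding pat_def
      by (rule sum_blocks[OF X[OF that] s, symmetric])
    finally show ?thesis .
  qed
  \<comment> \<open>At most \<open>2 ^ s\<close> rows stay unpaired in a block, one for each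
    pattern. A row belongs to at most \<open>card R\<close> pairs, so accumulators are added at most
    \<open>4 * h\<^sup>2\<close> times altogether.\<close>
  have cost_terms: "(\<Sum>\<rho>\<in>R. card (terms \<rho>)) \<le> b * 2 ^ s + 4 * h\<^sup>2"
  proof -
    have "card {q\<in>pairs. \<rho> \<in> q} \<le> 2 * h" if "\<rho> \<in> R" for \<rho>
    proof -
      have "{q\<in>pairs. \<rho> \<in> q} \<subseteq> (\<lambda>\<rho>'. {\<rho>, \<rho>'}) ` R"
      proof
        fix q assume "q \<in> {q\<in>pairs. \<rho> \<in> q}"
        then obtain \<beta> where "q \<in> Q \<beta>" "\<rho> \<in> q" by (auto simp: pairs_def)
        moreover from Q(2)[OF this(1)] obtain i j where "q = {i, j}" "i \<in> R" "j \<in> R" by blast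
        ultimately show "q \<in> (\<lambda>\<rho>'. {\<rho>, \<rho>'}) ` R" by (auto simp: insert_commute)
      qed
      then have "card {q\<in>pairs. \<rho> \<in> q} \<le> card ((\<lambda>\<rho>'. {\<rho>, \<rho>'}) ` R)"
        using R(1) by (intro card_mono) auto
      also have "\<dots> \<le> card R" using R(1) by (rule card_image_le)
      finally show ?thesis using R(2) by simp
    qed
    then have "(\<Sum>\<rho>\<in>R. card {q\<in>pairs. \<rho> \<in> q}) \<le> card R * (2 * h)"
      using sum_bounded_above[of R "\<lambda>\<rho>. card {q\<in>pairs. \<rho> \<in> q}" "2 * h"] by simp
    also have "\<dots> \<le> (2 * h) * (2 * h)" using R(2) by (intro mult_right_mono) auto
    finally have 1: "(\<Sum>\<rho>\<in>R. card {q\<in>pairs. \<rho> \<in> q}) \<le> 4 * h\<^sup>2" by (simp add: power2_eq_square)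
    have "(\<Sum>\<rho>\<in>R. card {\<beta>\<in>{..<b}. \<rho> \<in> U \<beta>}) = (\<Sum>\<beta><b. card {\<rho>\<in>R. \<rho> \<in> U \<beta>})"
      using sum.swap_restrict[OF R(1) finite_lessThan, where g = "\<lambda>_ _. 1::nat" and R = "\<lambda>\<rho> \<beta>. \<rho> \<in> U \<beta>"] by simp
    also have "\<dots> \<le> (\<Sum>\<beta><b. 2 ^ s)"
    proof (rule sum_mono)
      fix \<beta>
      have "{\<rho>\<in>R. \<rho> \<in> U \<beta>} = R - \<Union>(Q \<beta>)" by (auto simp: U_def)
      then show "card {\<rho>\<in>R. \<rho> \<in> U \<beta>} \<le> 2 ^ s"
        using Q(5)[of \<beta>] by (simp add: card_Pow)
    qed
    finally have 2: "(\<Sum>\<rho>\<in>R. card {\<beta>\<in>{..<b}. \<rho> \<in> U \<beta>}) \<le> b * 2 ^ s" by simp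
    have "(\<Sum>\<rho>\<in>R. card (terms \<rho>)) =
        (\<Sum>\<rho>\<in>R. card {q\<in>pairs. \<rho> \<in> q}) + (\<Sum>\<rho>\<in>R. card {\<beta>\<in>{..<b}. \<rho> \<in> U \<beta>})"
      unfolding terms_def sum.distrib[symmetric]
      by (intro sum.cong refl card_Plus) (use fin_pairs in auto)
    then show ?thesis using 1 2 by simp
  qed
  have "reachable n (k + b * h + (\<Sum>\<rho>\<in>R. card (terms \<rho>))) m
      (S \<union> u ` pairs \<union> (\<lambda>\<rho>. sum (val \<rho>) (terms \<rho>)) ` R)"
  proof (rule reachable_sums[OF reach1 R(1)])
    show "finite (terms \<rho>)" for \<rho> using fin_pairs by (auto simp: terms_def)
    show "val \<rho> ` terms \<rho> \<subseteq> insert 0 (S \<union> u ` pairs)" for \<rho>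
    proof
      fix v assume "v \<in> val \<rho> ` terms \<rho>"
      then consider q where "q \<in> pairs" "v = u q" | \<beta> where "\<beta> < b" "v = sum y (pat \<beta> \<rho>)"
        unfolding terms_def val_def by auto
      then show "v \<in> insert 0 (S \<union> u ` pairs)" using pats by cases blast+
    qed
  qed
  then show ?thesis
    by (rule reachable_mono) (use cost_terms row in auto)
qed

text \<open>The argument forms of the \<open>h\<close> products are cut at column
  \<open>s * b\<close>. The left parts use only functions known before the strip and are computed
  together by \<open>reachable_rows\<close>. A right part has at most \<open>s + h\<close> entries
  and is added when its product is due, so a product costs two right parts, two additions joining
  the halves and one AND: \<open>2 * s + 2 * h + 3\<close>. The table of block sums and the unpaired
  rows cost at most \<open>N * 2 ^ s\<close> each.\<close>

lemma reachable_strip: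
  assumes reach: "reachable n k m (y ` {..<N})" and s: "s > 0"
    and A: "\<And>i. i < h \<Longrightarrow> A i \<subseteq> {..<N + i}" and B: "\<And>i. i < h \<Longrightarrow> B i \<subseteq> {..<N + i}"
    and y: "\<And>i. i < h \<Longrightarrow> y (N + i) = sum y (A i) * sum y (B i)"
  shows "reachable n (k + (N div s) * h + 2 * N * 2 ^ s + 4 * h\<^sup>2 + h * (2 * s + 2 * h + 3)) (m + h)
    (y ` {..<N + h})"
proof -
  \<comment> \<open>Only complete blocks are used; the fewer than \<open>s\<close> leftover columns
    go to the right parts.\<close>
  define b where "b = N div s"
  have bs: "s * b \<le> N" "N < s * b + s"
    using dividend_less_times_div[OF s, of N] by (auto simp: b_def)
  define I where "I = (SIGMA \<beta>:{..<b}. Pow {\<beta> * s..<\<beta> * s + s})"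
  have finI: "finite I" by (auto simp: I_def)
  have block: "{\<beta> * s..<\<beta> * s + s} \<subseteq> {..<N}" if "\<beta> < b" for \<beta>
  proof -
    have "Suc \<beta> * s \<le> b * s" using that by (intro mult_right_mono) auto
    with bs show ?thesis by (auto simp: mult.commute)
  qed
  have "card I = b * 2 ^ s" by (simp add: I_def card_Pow)
  have cost: "(\<Sum>p\<in>I. card (snd p)) \<le> N * 2 ^ s"
  proof -
    have "card (snd p) \<le> s" if "p \<in> I" for p
    proof -
      from that have "snd p \<subseteq> {fst p * s..<fst p * s + s}" by (auto simp: I_def)
      from card_mono[OF _ this] show ?thesis by simp
    qed
    then have "(\<Sum>p\<in>I. card (snd p)) \<le> card I * s"
      using sum_bounded_above[of I "\<lambda>p. card (snd p)" s] by simp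
    also have "\<dots> = (s * b) * 2 ^ s" using \<open>card I = b * 2 ^ s\<close> by simp
    also have "\<dots> \<le> N * 2 ^ s" using bs by (intro mult_right_mono) auto
    finally show ?thesis .
  qed
  define S1 where "S1 = y ` {..<N} \<union> (\<lambda>p. sum y (snd p)) ` I"
  have "reachable n (k + (\<Sum>p\<in>I. card (snd p))) m S1"
    unfolding S1_def
  proof (rule reachable_sums[OF reach finI, where v = "\<lambda>_. y"])
    fix p assume p: "p \<in> I"
    then have "snd p \<subseteq> {fst p * s..<fst p * s + s}" "fst p < b" by (auto simp: I_def)
    with block have "snd p \<subseteq> {..<N}" by blast
    then show "finite (snd p)" "y ` snd p \<subseteq> insert 0 (y ` {..<N})"
      by (auto intro: finite_subset)
  qed
  then have reach1: "reachable n (k + N * 2 ^ s) m S1"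
    by (rule reachable_mono) (use cost in auto)
  define R where "R = {..<h} \<times> (UNIV :: bool set)"
  define form where "form = (\<lambda>(i, c). if c then A i else B i)"
  define S2 where "S2 = S1 \<union> (\<lambda>\<rho>. sum y (form \<rho> \<inter> {..<s * b})) ` R"
  have reach2: "reachable n (k + N * 2 ^ s + b * h + b * 2 ^ s + 4 * h\<^sup>2) m S2"
    unfolding S2_def
  proof (rule reachable_rows[OF reach1 _ _ s])
    show "finite R" by (simp add: R_def)
    show "card R \<le> 2 * h" by (simp add: R_def)
    fix \<beta> T assume "\<beta> < b" "T \<subseteq> {\<beta> * s..<\<beta> * s + s}"
    then have "(\<beta>, T) \<in> I" by (auto simp: I_def)
    from imageI[OF this, of "\<lambda>p. sum y (snd p)"] show "sum y T \<in> insert 0 S1"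
      unfolding S1_def by simp
  qed auto
  have "1 * b \<le> s * b" using s by (intro mult_right_mono) auto
  with bs have "b \<le> N" by linarith
  then have "b * 2 ^ s \<le> N * 2 ^ s" by (intro mult_right_mono) auto
  then have reach3: "reachable n (k + b * h + 2 * N * 2 ^ s + 4 * h\<^sup>2) m S2"
    by (intro reachable_mono[OF reach2]) auto
  have "reachable n (k + b * h + 2 * N * 2 ^ s + 4 * h\<^sup>2 + j * (2 * s + 2 * h + 3)) (m + j)
      (S2 \<union> y ` {..<N + j})" if "j \<le> h" for j
    using that
  proof (induction j)
    case 0
    have "S2 \<union> y ` {..<N + 0} = S2" by (auto simp: S2_def S1_def)
    then show ?case using reach3 by simp
  next
    case (Suc j)
    define K where "K = k + b * h + 2 * N * 2 ^ s + 4 * h\<^sup>2 + j * (2 * s + 2 * h + 3)"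
    define S where "S = S2 \<union> y ` {..<N + j}"
    have j: "j < h" using Suc.prems by simp
    have IH: "reachable n K (m + j) S" using Suc by (simp add: K_def S_def)
    define tail where "tail = (\<lambda>H. sum y (H \<inter> {s * b..}))"
    have card_tail: "card (H \<inter> {s * b..}) \<le> s + h" and fin: "finite H" if "H \<subseteq> {..<N + j}" for H
    proof -
      have "card (H \<inter> {s * b..}) \<le> card {s * b..<N + j}"
        using that by (intro card_mono) auto
      also have "\<dots> \<le> s + h" using bs j by simp
      finally show "card (H \<inter> {s * b..}) \<le> s + h" .
      show "finite H" using that finite_subset by blast
    qed
    have split: "sum y H = sum y (H \<inter> {..<s * b}) + tail H" if "H \<subseteq> {..<N + j}" for H
    proof -
      have "sum y H = sum y (H \<inter> {..<s * b}) + sum y (H - {..<s * b})"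
        using fin[OF that] by (rule sum.Int_Diff)
      also have "H - {..<s * b} = H \<inter> {s * b..}" by auto
      finally show ?thesis by (simp add: tail_def)
    qed
    have step: "reachable n (k' + (s + h) + 1) m' (insert (sum y H) S')"
      if "reachable n k' m' S'" "S \<subseteq> S'" "H \<subseteq> {..<N + j}" "sum y (H \<inter> {..<s * b}) \<in> S" for k' m' S' H
    proof -
      have "y ` (H \<inter> {s * b..}) \<subseteq> y ` {..<N + j}" using that(3) by blast
      also have "\<dots> \<subseteq> insert 0 S'" using that(2) unfolding S_def by blast
      finally have "reachable n (k' + card (H \<inter> {s * b..})) m' (insert (tail H) S')"
        unfolding tail_def using fin[OF that(3)] by (intro reachable_sum[OF that(1)]) auto
      then have "reachable n (Suc (k' + card (H \<inter> {s * b..}))) m'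
          (insert (sum y (H \<inter> {..<s * b}) + tail H) (insert (tail H) S'))"
        by (rule reachable_xor) (use that(2,4) in blast)+
      then show ?thesis unfolding split[OF that(3)]
        by (rule reachable_mono) (use card_tail[OF that(3)] in auto)
    qed
    have "(j, c) \<in> R" for c using j by (simp add: R_def)
    from imageI[OF this, of "\<lambda>\<rho>. sum y (form \<rho> \<inter> {..<s * b})"]
    have "sum y (form (j, c) \<inter> {..<s * b}) \<in> S" for c
      unfolding S_def S2_def by blast
    from this[of True] this[of False]
    have forms: "sum y (A j \<inter> {..<s * b}) \<in> S" "sum y (B j \<inter> {..<s * b}) \<in> S"
      by (simp_all add: form_def)
    have "reachable n (K + (s + h) + 1 + (s + h) + 1) (m + j)
        (insert (sum y (B j)) (insert (sum y (A j)) S))"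
      by (intro step IH A B forms) (use j in auto)
    then have "reachable n (Suc (K + (s + h) + 1 + (s + h) + 1)) (Suc (m + j))
        (insert (sum y (A j) * sum y (B j)) (insert (sum y (B j)) (insert (sum y (A j)) S)))"
      by (rule reachable_and) auto
    moreover have "S2 \<union> y ` {..<N + Suc j} = insert (sum y (A j) * sum y (B j)) S"
      unfolding S_def y[OF j, symmetric] by (auto simp: lessThan_Suc)
    ultimately show ?case
      by (elim reachable_mono) (auto simp: K_def)
  qed
  from this[of h] show ?thesis
    by (rule reachable_mono) (auto simp: b_def)
qed

section \<open>Summing the costs of the strips\<close>

definition strip_cost :: "nat \<Rightarrow> nat \<Rightarrow> nat \<Rightarrow> nat" where
  "strip_cost s h N = (N div s) * h + 2 * N * 2 ^ s + 4 * h\<^sup>2 + h * (2 * s + 2 * h + 3)"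

lemma reachable_strips:
  assumes s: "s > 0" and src: "\<And>i. i \<le> n \<Longrightarrow> y i = source n i"
    and A: "\<And>i. A i \<subseteq> {..<n+1+i}" and B: "\<And>i. B i \<subseteq> {..<n+1+i}"
    and y: "\<And>i. y (n+1+i) = sum y (A i) * sum y (B i)"
  shows "reachable n (1 + (\<Sum>q<p. strip_cost s h (n+1+q*h))) (p * h) (y ` {..<n+1+p*h})"
proof (induction p)
  case 0
  have "y ` {..<n+1} = source n ` {..n}" using src by (auto simp: less_Suc_eq_le)
  then show ?case using reachable_source by simp
next
  case (Suc p)
  have "reachable n (1 + (\<Sum>q<p. strip_cost s h (n+1+q*h)) + ((n+1+p*h) div s) * h + 2 * (n+1+p*h) * 2 ^ s
      + 4 * h\<^sup>2 + h * (2 * s + 2 * h + 3)) (p * h + h) (y ` {..<n+1+p*h + h})"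
  proof (rule reachable_strip[OF Suc s])
    show "A (p * h + i) \<subseteq> {..<n+1+p*h+i}" "B (p * h + i) \<subseteq> {..<n+1+p*h+i}" for i
      using A[of "p * h + i"] B[of "p * h + i"] by (simp_all add: ac_simps)
    show "y (n + 1 + p * h + i) = sum y (A (p * h + i)) * sum y (B (p * h + i))" for i
      using y[of "p * h + i"] by (simp add: ac_simps)
  qed
  then show ?case
    by (rule reachable_mono) (auto simp: strip_cost_def ac_simps)
qed

text \<open>The \<open>P\<close> strips may cover more than \<open>M\<close> products; the surplus
  comes from the padding of the normal form. The function itself is one more linear form with at
  most \<open>n + 1 + M\<close> terms, which are added singly. The new circuit may have more
  conjunctions than \<open>C\<close>; only its total complexity is bounded.\<close>

lemma total_complexity_upper:
  assumes C: "wf_circuit n C" "implements n C f" "mult_compl C = M"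
    and s: "s > 0" and P: "M \<le> P * h"
  shows "\<exists>C'. wf_circuit n C' \<and> implements n C' f \<and>
    total_compl C' \<le> 1 + (\<Sum>q<P. strip_cost s h (n+1+q*h)) + (n + 1 + M)"
proof -
  from C have "computes n (node_funs n C) (length C) M" "bfun_of n f \<in> node_funs n C"
    using circuit_computes implements_iff by blast+
  then obtain y A B F where y: "\<And>i. i \<le> n \<Longrightarrow> y i = source n i"
    "\<And>i. A i \<subseteq> {..<n+1+i}" "\<And>i. B i \<subseteq> {..<n+1+i}"
    "\<And>i. y (n+1+i) = sum y (A i) * sum y (B i)"
    "F \<subseteq> {..<n+1+M}" "bfun_of n f = sum y F"
    by (rule computes_infinite_normal_form) blast
  have "F \<subseteq> {..<n+1+P*h}" using y(5) P by force
  then have "reachable n (1 + (\<Sum>q<P. strip_cost s h (n+1+q*h)) + card F) (P * h)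
      (insert (sum y F) (y ` {..<n+1+P*h}))"
    by (intro reachable_sum reachable_strips[OF s y(1-4)]) (auto intro: finite_subset)
  then obtain S k m where S: "computes n S k m"
    "k \<le> 1 + (\<Sum>q<P. strip_cost s h (n+1+q*h)) + card F" "bfun_of n f \<in> S"
    unfolding reachable_def y(6) by auto
  moreover have "card F \<le> n + 1 + M" using card_mono[OF _ y(5)] by simp
  ultimately have "k \<le> 1 + (\<Sum>q<P. strip_cost s h (n+1+q*h)) + (n + 1 + M)" by linarith
  with circuit_iff_computes[of n f m k] S show ?thesis by blast
qed

text \<open>The main terms \<open>h * N / s\<close> form an arithmetic progression in the strip
  number; their sum is about half the number of entries of the staircase matrix, divided by
  \<open>s\<close>. Rounding up to whole strips replaces \<open>M\<close> by
  \<open>M + h\<close>.\<close>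

lemma sum_strip_cost_le:
  assumes s: "s > 0" and h: "h > 0" and P: "P = M div h + 1"
  shows "real (1 + (\<Sum>q<P. strip_cost s h (n+1+q*h)) + (n + 1 + M)) \<le>
    (real M + real h) * (real M + real h + 2 * real n + 2) / (2 * real s) +
    2 * real P * (real n + 1 + real M) * 2 ^ s +
    (real M + real h) * (6 * real h + 2 * real s + 3) + (real n + real M + 2)"
proof -
  have Ph: "real P * real h \<le> real M + real h"
  proof -
    have "P * h = M div h * h + h" by (simp add: P)
    also have "\<dots> \<le> M + h" by simp
    finally show ?thesis by (metis of_nat_add of_nat_le_iff of_nat_mult)
  qed
  have one: "real (strip_cost s h (n+1+q*h)) \<le>
      (real h * (real n + 1) / s + real h * real h / s * real q) + 2 * (real n + 1 + real M) * 2 ^ s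
        + real h * (6 * real h + 2 * real s + 3)" if "q < P" for q
  proof -
    have "q * h \<le> (M div h) * h" using that by (intro mult_right_mono) (auto simp: P)
    also have "\<dots> \<le> M" by simp
    finally have "real (n+1+q*h) \<le> real n + 1 + real M" by (simp flip: of_nat_mult of_nat_le_iff)
    then have "2 * real (n+1+q*h) * 2 ^ s \<le> 2 * (real n + 1 + real M) * 2 ^ s"
      by (intro mult_right_mono mult_left_mono) auto
    then have 1: "real (2 * (n+1+q*h) * 2 ^ s) \<le> 2 * (real n + 1 + real M) * 2 ^ s"
      by (simp only: of_nat_mult of_nat_power of_nat_numeral)
    have "real ((n+1+q*h) div s) * real h \<le> real (n+1+q*h) / real s * real h"
      by (intro mult_right_mono of_nat_div_le_of_nat) simp
    also have "\<dots> = real h * (real n + 1) / s + real h * real h / s * real q"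
      using s by (simp add: field_simps)
    finally have 2: "real (((n+1+q*h) div s) * h) \<le> real h * (real n + 1) / s + real h * real h / s * real q"
      by simp
    have 3: "real (4 * h\<^sup>2 + h * (2 * s + 2 * h + 3)) = real h * (6 * real h + 2 * real s + 3)"
      by (simp add: power2_eq_square algebra_simps)
    show ?thesis unfolding strip_cost_def using 1 2 3 by linarith
  qed
  have gauss: "(\<Sum>q<P. real q) \<le> real P * real P / 2"
    by (induction P) (auto simp: field_simps)
  have "(\<Sum>q<P. real (strip_cost s h (n+1+q*h))) \<le> (\<Sum>q<P. (real h * (real n + 1) / s + real h * real h / s * real q)
       + 2 * (real n + 1 + real M) * 2 ^ s + real h * (6 * real h + 2 * real s + 3))"
    using one by (intro sum_mono) auto
  also have "\<dots> = real P * real h * (real n + 1) / s + real h * real h / s * (\<Sum>q<P. real q) +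
      2 * real P * (real n + 1 + real M) * 2 ^ s + (real P * real h) * (6 * real h + 2 * real s + 3)"
    by (simp add: sum.distrib sum_distrib_left sum_divide_distrib algebra_simps)
  also have "real h * real h / s * (\<Sum>q<P. real q) \<le> real h * real h / s * (real P * real P / 2)"
    by (intro mult_left_mono gauss) simp
  also have "real h * real h / s * (real P * real P / 2) = (real P * real h) * (real P * real h) / (2 * real s)"
    by (simp add: mult_ac)
  also have "\<dots> \<le> (real M + real h) * (real M + real h) / (2 * real s)"
    by (intro divide_right_mono mult_mono Ph) auto
  also have "real P * real h * (real n + 1) / s \<le> (real M + real h) * (real n + 1) / s"
    by (intro divide_right_mono mult_right_mono Ph) auto
  also have "(real P * real h) * (6 * real h + 2 * real s + 3) \<le> (real M + real h) * (6 * real h + 2 * real s + 3)"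
    by (intro mult_right_mono Ph) auto
  finally have "(\<Sum>q<P. real (strip_cost s h (n+1+q*h))) \<le>
      (real M + real h) * (real n + 1) / s + (real M + real h) * (real M + real h) / (2 * real s) +
      2 * real P * (real n + 1 + real M) * 2 ^ s + (real M + real h) * (6 * real h + 2 * real s + 3)"
    by simp
  moreover have "(real M + real h) * (real n + 1) / s + (real M + real h) * (real M + real h) / (2 * real s) =
      (real M + real h) * (real M + real h + 2 * real n + 2) / (2 * real s)"
    using s by (simp add: field_simps)
  ultimately show ?thesis by simp
qed

text \<open>With l = log M, strips of about M / l^2 gates and 2^(block width) of about M / l^4 make all
  contributions other than the paired additions of order M^2 / l^2.\<close>

definition strip_height :: "nat \<Rightarrow> nat" where
  "strip_height M = nat \<lceil>real M / (log 2 M)\<^sup>2\<rceil>"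

text \<open>The \<open>+ 1\<close> makes the width s positive for every \<open>M\<close>, since
  \<open>nat\<close> turns a negative floor into 0. The factor 4 has this origin: about l^2 strips
  each pay about M * 2^s for block sums and unpaired rows, and 2^s of order M / l^4 leaves M^2 /
  l^2, below the main term of order M^2 / l.\<close>

definition block_width :: "nat \<Rightarrow> nat" where
  "block_width M = nat \<lfloor>log 2 M - 4 * log 2 (log 2 M)\<rfloor> + 1"

definition strip_count :: "nat \<Rightarrow> nat" where
  "strip_count M = M div strip_height M + 1"

text \<open>This is the bound of \<open>sum_strip_cost_le\<close> divided by M (M + 2 n) / log M,
  minus 1/2, after \<open>n\<close> has been estimated away. The first summand comes from the main
  term, the rest from the error terms; \<open>K\<close> will be \<open>2 + 1 / c\<close>, so that n
  + 1 + M \<le> K M.\<close>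

definition upper_eps :: "real \<Rightarrow> nat \<Rightarrow> real" where
  "upper_eps K M =
    ((1 + strip_height M / M) * (1 + strip_height M / M + 2 / M) * (log 2 M / block_width M) - 1) / 2 +
    (2 * K * (log 2 M * strip_count M * 2 ^ block_width M / M) +
     (1 + strip_height M / M) * (6 * (log 2 M * strip_height M / M) +
        2 * (log 2 M * block_width M / M) + 3 * (log 2 M / M)) +
     (K + 1) * (log 2 M / M))"

lemma strip_height_bounds:
  assumes "M \<ge> 2"
  shows "real (strip_height M) \<le> M / (log 2 M)\<^sup>2 + 1" "M / (log 2 M)\<^sup>2 \<le> strip_height M"
    "strip_height M > 0"
proof -
  have "log 2 M > 0" using assms by simp
  then have pos: "real M / (log 2 M)\<^sup>2 > 0"
    by (intro divide_pos_pos zero_less_power) (use assms in auto)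
  then show "strip_height M > 0" unfolding strip_height_def by simp
  show "real (strip_height M) \<le> M / (log 2 M)\<^sup>2 + 1" "M / (log 2 M)\<^sup>2 \<le> strip_height M"
    using pos unfolding strip_height_def by linarith+
qed

lemma strip_count_le:
  assumes "M \<ge> 2"
  shows "real (strip_count M) \<le> (log 2 M)\<^sup>2 + 1"
proof -
  have l: "log 2 M > 0" using assms by simp
  have "real (M div strip_height M) \<le> M / strip_height M" by (rule of_nat_div_le_of_nat)
  also have "\<dots> \<le> M / (M / (log 2 M)\<^sup>2)"
    by (intro divide_left_mono strip_height_bounds(2) mult_pos_pos divide_pos_pos zero_less_power l)
      (use assms strip_height_bounds(3)[OF assms] in auto)
  also have "\<dots> = (log 2 M)\<^sup>2" using assms by simp
  finally show ?thesis by (simp add: strip_count_def)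
qed

lemma eventually_block_width:
  "\<forall>\<^sub>F M in sequentially. log 2 M - 4 * log 2 (log 2 M) \<le> block_width M \<and>
     block_width M \<le> log 2 M - 4 * log 2 (log 2 M) + 1 \<and> 2 ^ block_width M \<le> 2 * (M / (log 2 M) ^ 4)"
proof -
  have "\<forall>\<^sub>F M :: nat in sequentially. log 2 M - 4 * log 2 (log 2 M) \<ge> 0 \<and> log 2 M > 1"
    by (intro eventually_conj; real_asymp)
  then show ?thesis using eventually_ge_at_top[of 2]
  proof eventually_elim
    case (elim M)
    define t where "t = log 2 M - 4 * log 2 (log 2 M)"
    have t: "t \<ge> 0" using elim by (simp add: t_def)
    then have b: "t \<le> block_width M" "block_width M \<le> t + 1"
      unfolding block_width_def t_def[symmetric] by linarith+
    have "(2::real) ^ block_width M = 2 powr block_width M" by (simp add: powr_realpow)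
    also have "\<dots> \<le> 2 powr (t + 1)" using b by simp
    also have "\<dots> = 2 * (2 powr log 2 M / (2 powr log 2 (log 2 M)) powr 4)"
      unfolding t_def by (simp add: powr_add powr_diff powr_powr mult.commute)
    also have "\<dots> = 2 * (M / (log 2 M) ^ 4)" using elim by (simp add: powr_numeral)
    finally show ?case using b by (simp add: t_def)
  qed
qed

text \<open>All ratios tend to 0 except \<open>log 2 M / block_width M\<close>, which tends to 1
  because log log M is negligible against log M; the first summand therefore tends to (1 - 1) /
  2.\<close>

lemma upper_eps_tendsto_0: "upper_eps K \<longlonglongrightarrow> 0"
proof -
  have ge2: "\<forall>\<^sub>F M :: nat in sequentially. M \<ge> 2" by (rule eventually_ge_at_top)
  have a: "(\<lambda>M. strip_height M / M) \<longlonglongrightarrow> 0"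
  proof (rule tendsto_sandwich[OF _ _ tendsto_const])
    show "\<forall>\<^sub>F M :: nat in sequentially. strip_height M / M \<le> (M / (log 2 M)\<^sup>2 + 1) / M"
      using ge2 by eventually_elim (intro divide_right_mono strip_height_bounds, auto)
    show "(\<lambda>M :: nat. (M / (log 2 M)\<^sup>2 + 1) / M) \<longlonglongrightarrow> 0" by real_asymp
  qed simp
  have b: "(\<lambda>M. log 2 M * strip_height M / M) \<longlonglongrightarrow> 0"
  proof (rule tendsto_sandwich[OF _ _ tendsto_const])
    show "\<forall>\<^sub>F M :: nat in sequentially. log 2 M * strip_height M / M \<le> log 2 M * (M / (log 2 M)\<^sup>2 + 1) / M"
      using ge2 by eventually_elim (intro divide_right_mono mult_left_mono strip_height_bounds, auto)
    show "\<forall>\<^sub>F M :: nat in sequentially. 0 \<le> log 2 M * strip_height M / M"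
      using ge2 by eventually_elim auto
    show "(\<lambda>M :: nat. log 2 M * (M / (log 2 M)\<^sup>2 + 1) / M) \<longlonglongrightarrow> 0" by real_asymp
  qed
  have pos: "\<forall>\<^sub>F M :: nat in sequentially. log 2 M - 4 * log 2 (log 2 M) > 0" by real_asymp
  have r: "(\<lambda>M. log 2 M / block_width M) \<longlonglongrightarrow> 1"
  proof (rule tendsto_sandwich)
    show "\<forall>\<^sub>F M :: nat in sequentially.
        log 2 M / (log 2 M - 4 * log 2 (log 2 M) + 1) \<le> log 2 M / block_width M"
      using ge2 eventually_block_width pos by eventually_elim (intro divide_left_mono, auto)
    show "\<forall>\<^sub>F M :: nat in sequentially.
        log 2 M / block_width M \<le> log 2 M / (log 2 M - 4 * log 2 (log 2 M))"
      using ge2 eventually_block_width pos by eventually_elim (intro divide_left_mono, auto)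
  qed real_asymp+
  have d: "(\<lambda>M. log 2 M * strip_count M * 2 ^ block_width M / M) \<longlonglongrightarrow> 0"
  proof (rule tendsto_sandwich[OF _ _ tendsto_const])
    show "\<forall>\<^sub>F M :: nat in sequentially. log 2 M * strip_count M * 2 ^ block_width M / M \<le>
        log 2 M * ((log 2 M)\<^sup>2 + 1) * (2 * (M / (log 2 M) ^ 4)) / M"
      using ge2 eventually_block_width
      by eventually_elim (intro divide_right_mono mult_mono strip_count_le, auto)
    show "\<forall>\<^sub>F M :: nat in sequentially. 0 \<le> log 2 M * strip_count M * 2 ^ block_width M / M"
      using ge2 by eventually_elim auto
    show "(\<lambda>M :: nat. log 2 M * ((log 2 M)\<^sup>2 + 1) * (2 * (M / (log 2 M) ^ 4)) / M) \<longlonglongrightarrow> 0" by real_asymp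
  qed
  have e: "(\<lambda>M. log 2 M * block_width M / M) \<longlonglongrightarrow> 0"
  proof (rule tendsto_sandwich[OF _ _ tendsto_const])
    show "\<forall>\<^sub>F M :: nat in sequentially. log 2 M * block_width M / M \<le>
        log 2 M * (log 2 M - 4 * log 2 (log 2 M) + 1) / M"
      using ge2 eventually_block_width
      by eventually_elim (intro divide_right_mono mult_left_mono, auto)
    show "\<forall>\<^sub>F M :: nat in sequentially. 0 \<le> log 2 M * block_width M / M"
      using ge2 by eventually_elim auto
    show "(\<lambda>M :: nat. log 2 M * (log 2 M - 4 * log 2 (log 2 M) + 1) / M) \<longlonglongrightarrow> 0" by real_asymp
  qed
  have g: "(\<lambda>M :: nat. log 2 M / M) \<longlonglongrightarrow> 0" by real_asymp
  have inv: "(\<lambda>M :: nat. 2 / M) \<longlonglongrightarrow> 0" by real_asymp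
  have "upper_eps K \<longlonglongrightarrow> ((1 + 0) * (1 + 0 + 0) * 1 - 1) / 2 +
      (2 * K * 0 + (1 + 0) * (6 * 0 + 2 * 0 + 3 * 0) + (K + 1) * 0)"
    unfolding upper_eps_def[abs_def] by (intro tendsto_intros a b r d e g inv) simp_all
  then show ?thesis by simp
qed

text \<open>The factor x + 2 N stays exact in the main term \<open>E\<close>; only the lower-order
  terms, gathered in \<open>R\<close>, use N \<le> x / c, and they are then enlarged from x * x to x
  * (x + 2 N). Hence the error depends on \<open>c\<close> and \<open>M\<close> but not on
  \<open>n\<close>.\<close>

lemma total_complexity_asymptotic_upper:
  assumes c: "c > 0" and C: "wf_circuit n C" "implements n C f" "mult_compl C = M"
    and M: "real M \<ge> c * real n" "M \<ge> 2"
  shows "\<exists>C'. wf_circuit n C' \<and> implements n C' f \<and>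
    real (total_compl C') \<le>
      (1/2 + upper_eps (2 + 1 / c) M) * (real M * (real M + 2 * real n)) / log 2 (real M)"
proof -
  define x N h s l P K where "x = real M" and "N = real n" and "h = real (strip_height M)"
    and "s = real (block_width M)" and "l = log 2 x" and "P = real (strip_count M)" and "K = 2 + 1 / c"
  note defs = this
  have x: "x \<ge> 2" using M by (simp add: defs)
  have l: "l > 0" using x by (simp add: l_def)
  have s: "s > 0" "block_width M > 0" by (simp_all add: s_def block_width_def)
  have h: "h \<ge> 0" "N \<ge> 0" "P \<ge> 0" by (simp_all add: defs)
  have "N \<le> x / c" using M(1) c by (simp add: N_def x_def field_simps)
  then have NK: "N + 1 + x \<le> K * x" "N + x + 2 \<le> (K + 1) * x"
    using x by (simp_all add: K_def field_simps)
  have "M \<le> strip_count M * strip_height M"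
    using dividend_less_div_times[OF strip_height_bounds(3)[OF M(2)], of M]
    by (simp add: strip_count_def)
  from total_complexity_upper[OF C s(2) this] obtain C' where C': "wf_circuit n C'" "implements n C' f"
    "total_compl C' \<le> 1 + (\<Sum>q<strip_count M. strip_cost (block_width M) (strip_height M) (n+1+q*strip_height M)) + (n + 1 + M)"
    by blast
  define R where "R = 2 * K * (P * 2 ^ block_width M / x) +
    (1 + h / x) * (6 * (h / x) + 2 * (s / x) + 3 * (1 / x)) + (K + 1) * (1 / x)"
  define E where "E = (1 + h / x) * (1 + h / x + 2 / x) / (2 * s)"
  have main: "(x + h) * (x + h + 2 * N + 2) / (2 * s) \<le> x * (x + 2 * N) * E"
  proof -
    have "1 * (h + 2) \<le> (x + 2 * N) / x * (h + 2)" using x h by (intro mult_right_mono) auto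
    moreover have "(x + 2 * N) * (1 + h / x + 2 / x) = (x + 2 * N) + (x + 2 * N) / x * (h + 2)"
      using x by (simp add: field_simps)
    ultimately have "x + h + 2 * N + 2 \<le> (x + 2 * N) * (1 + h / x + 2 / x)"
      using add_left_mono[of "1 * (h + 2)" "(x + 2 * N) / x * (h + 2)" "x + 2 * N"]
      by (simp only: mult_1 ac_simps)
    then have "(x + h) * (x + h + 2 * N + 2) \<le> (x + h) * ((x + 2 * N) * (1 + h / x + 2 / x))"
      using x h by (intro mult_left_mono) auto
    then have "(x + h) * (x + h + 2 * N + 2) / (2 * s) \<le> (x + h) * ((x + 2 * N) * (1 + h / x + 2 / x)) / (2 * s)"
      using s by (intro divide_right_mono) auto
    also have "(x + h) * ((x + 2 * N) * (1 + h / x + 2 / x)) =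
        (x * (1 + h / x)) * ((x + 2 * N) * (1 + h / x + 2 / x))"
      using x by (simp add: distrib_left)
    also have "\<dots> / (2 * s) = x * (x + 2 * N) * E" by (simp add: E_def mult_ac)
    finally show ?thesis .
  qed
  have "2 * P * (K * x) * 2 ^ block_width M = x * x * (2 * K * (P * 2 ^ block_width M / x))"
    "(x + h) * (6 * h + 2 * s + 3) = x * x * ((1 + h / x) * (6 * (h / x) + 2 * (s / x) + 3 * (1 / x)))"
    "(K + 1) * x = x * x * ((K + 1) * (1 / x))"
    using x by (simp_all add: field_simps)
  then have rest: "2 * P * (K * x) * 2 ^ block_width M + ((x + h) * (6 * h + 2 * s + 3) + (K + 1) * x) = x * x * R"
    unfolding R_def by (simp only: distrib_left add.assoc)
  have "R \<ge> 0" unfolding R_def K_def using x h s c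
    by (intro add_nonneg_nonneg mult_nonneg_nonneg) auto
  then have R: "x * x * R \<le> x * (x + 2 * N) * R"
    using x h by (intro mult_right_mono mult_left_mono) auto
  have "real (total_compl C') \<le>
      real (1 + (\<Sum>q<strip_count M. strip_cost (block_width M) (strip_height M) (n+1+q*strip_height M)) + (n + 1 + M))"
    using C'(3) by (simp only: of_nat_le_iff)
  also have "\<dots> \<le> (x + h) * (x + h + 2 * N + 2) / (2 * s) + 2 * P * (N + 1 + x) * 2 ^ block_width M +
      (x + h) * (6 * h + 2 * s + 3) + (N + x + 2)"
    unfolding defs by (rule sum_strip_cost_le[OF s(2) strip_height_bounds(3)[OF M(2)] strip_count_def])
  also have "\<dots> \<le> x * (x + 2 * N) * E + 2 * P * (K * x) * 2 ^ block_width M +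
      (x + h) * (6 * h + 2 * s + 3) + (K + 1) * x"
    using NK h s by (intro add_mono main mult_right_mono mult_left_mono) auto
  also have "\<dots> = x * (x + 2 * N) * E + x * x * R"
    by (simp only: rest[symmetric] add.assoc)
  also have "\<dots> \<le> x * (x + 2 * N) * E + x * (x + 2 * N) * R" using R by simp
  also have "\<dots> = x * (x + 2 * N) * (E + R)" by (simp only: distrib_left)
  also have "E + R = (1/2 + upper_eps K M) / l"
  proof -
    have "l * E = (1 + h / x) * (1 + h / x + 2 / x) * (l / s) / 2" unfolding E_def by (simp add: mult_ac)
    moreover have "l * R = 2 * K * (l * P * 2 ^ block_width M / x) +
        (1 + h / x) * (6 * (l * h / x) + 2 * (l * s / x) + 3 * (l / x)) + (K + 1) * (l / x)"
      unfolding R_def by (simp add: algebra_simps)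
    ultimately have "l * (E + R) = 1/2 + upper_eps K M"
      unfolding upper_eps_def defs(1)[symmetric] defs(3-6)[symmetric]
      by (simp add: distrib_left diff_divide_distrib)
    then show ?thesis using l by (simp add: field_simps)
  qed
  finally have "real (total_compl C') \<le> (1/2 + upper_eps K M) * (x * (x + 2 * N)) / l"
    by (simp add: mult.commute)
  with C' show ?thesis unfolding defs by blast
qed

section \<open>Counting functions of small total complexity\<close>

text \<open>Gates with different functions can be told apart by these functions, so different
  labellings never give the same labelled circuit.\<close>

definition reduced_circuit :: "nat \<Rightarrow> circuit \<Rightarrow> bool" where
  "reduced_circuit n C \<longleftrightarrow> wf_circuit n C \<and> inj_on (\<lambda>j. node_fun n C (n + 1 + j)) {..<length C}"

lemma reduced_circuit_snoc:
  assumes "reduced_circuit n C" "fst (gate_args g) < n + 1 + length C" "snd (gate_args g) < n + 1 + length C"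
    "bfun_of n (\<lambda>xs. eval_gate (node_values C xs) g) \<notin> node_funs n C"
  shows "reduced_circuit n (C @ [g])"
proof -
  have old: "node_fun n (C @ [g]) (n + 1 + j) = node_fun n C (n + 1 + j)" if "j < length C" for j
    using that by (intro node_fun_snoc_old) simp
  have new: "node_fun n (C @ [g]) (n + 1 + length C) \<notin> node_funs n C"
    using assms(4) by (simp only: node_fun_snoc_new not_False_eq_True)
  have mem: "node_fun n C (n + 1 + j) \<in> node_funs n C" if "j < length C" for j
    unfolding node_funs_def using that by (intro imageI) simp
  have "inj_on (\<lambda>j. node_fun n (C @ [g]) (n + 1 + j)) (insert (length C) {..<length C})"
    unfolding inj_on_insert
  proof
    show "inj_on (\<lambda>j. node_fun n (C @ [g]) (n + 1 + j)) {..<length C}"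
      using assms(1) old unfolding reduced_circuit_def inj_on_def by (metis lessThan_iff)
    show "node_fun n (C @ [g]) (n + 1 + length C) \<notin>
        (\<lambda>j. node_fun n (C @ [g]) (n + 1 + j)) ` ({..<length C} - {length C})"
      using new mem old by (metis (no_types, lifting) DiffD1 imageE lessThan_iff)
  qed
  then show ?thesis
    using assms(1-3) by (simp add: reduced_circuit_def wf_circuit_snoc lessThan_Suc)
qed

text \<open>A gate whose function is already available is left out, so no function is computed
  twice.\<close>

lemma computes_reduced_circuit:
  assumes "computes n S k m"
  shows "\<exists>C. reduced_circuit n C \<and> length C \<le> k \<and> node_funs n C = S"
  using assms
proof (induction rule: computes.induct)
  case computes_source
  show ?case by (rule exI[of _ "[]"]) (simp add: node_funs_Nil reduced_circuit_def)
next
  case (computes_xor S k m u v)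
  then obtain C i j where C: "reduced_circuit n C" "length C \<le> k" "node_funs n C = S"
    "i < n + 1 + length C" "u = node_fun n C i" "j < n + 1 + length C" "v = node_fun n C j"
    by (auto simp: node_funs_def)
  have new: "bfun_of n (\<lambda>xs. eval_gate (node_values C xs) (Xor i j)) = u + v"
    using C by (simp add: bfun_of_xor node_fun_def)
  show ?case
  proof (cases "u + v \<in> S")
    case True
    then show ?thesis using C by (intro exI[of _ C]) auto
  next
    case False
    then have "reduced_circuit n (C @ [Xor i j])"
      using C new by (intro reduced_circuit_snoc) auto
    moreover have "node_funs n (C @ [Xor i j]) = insert (u + v) S"
      using C new by (simp only: node_funs_snoc)
    ultimately show ?thesis using C by (intro exI[of _ "C @ [Xor i j]"]) auto
  qed
next
  case (computes_and S k m u v)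
  then obtain C i j where C: "reduced_circuit n C" "length C \<le> k" "node_funs n C = S"
    "i < n + 1 + length C" "u = node_fun n C i" "j < n + 1 + length C" "v = node_fun n C j"
    by (auto simp: node_funs_def)
  have new: "bfun_of n (\<lambda>xs. eval_gate (node_values C xs) (And i j)) = u * v"
    using C by (simp add: bfun_of_and node_fun_def)
  show ?case
  proof (cases "u * v \<in> S")
    case True
    then show ?thesis using C by (intro exI[of _ C]) auto
  next
    case False
    then have "reduced_circuit n (C @ [And i j])"
      using C new by (intro reduced_circuit_snoc) auto
    moreover have "node_funs n (C @ [And i j]) = insert (u * v) S"
      using C new by (simp only: node_funs_snoc)
    ultimately show ?thesis using C by (intro exI[of _ "C @ [And i j]"]) auto
  qed
qed

text \<open>A labelled circuit is a map from gate labels to gates in which the labels need not respect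
  the order of evaluation; the relation below evaluates the nodes reachable from the sources.\<close>

inductive node_value :: "nat \<Rightarrow> (nat \<Rightarrow> gate) \<Rightarrow> nat \<Rightarrow> bfun \<Rightarrow> bool" for n D where
  node_value_source: "i \<le> n \<Longrightarrow> node_value n D i (source n i)"
| node_value_xor: "D j = Xor a b \<Longrightarrow> node_value n D a u \<Longrightarrow> node_value n D b v \<Longrightarrow>
    node_value n D (n + 1 + j) (u + v)"
| node_value_and: "D j = And a b \<Longrightarrow> node_value n D a u \<Longrightarrow> node_value n D b v \<Longrightarrow>
    node_value n D (n + 1 + j) (u * v)"

text \<open>The node number decides which rule applies: a source up to \<open>n\<close>, otherwise
  the gate \<open>D j\<close>. Derivations are finite trees, so this holds even if \<open>D\<close>
  contains cycles. It is what allows a function to be decoded from a labelled circuit.\<close>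

lemma node_value_unique: "node_value n D k u \<Longrightarrow> node_value n D k v \<Longrightarrow> u = v"
proof (induction arbitrary: v rule: node_value.induct)
  case (node_value_source i)
  from node_value_source.prems node_value_source.hyps show ?case by cases auto
next
  case (node_value_xor j a b u w)
  note hyps = node_value_xor.hyps(1) and IH = node_value_xor.IH
  from node_value_xor.prems show ?case
  proof cases
    case (node_value_xor j' a' b' u' w')
    with hyps have "a' = a" "b' = b" by simp_all
    with node_value_xor IH show ?thesis by metis
  qed (use hyps in simp_all)
next
  case (node_value_and j a b u w)
  note hyps = node_value_and.hyps(1) and IH = node_value_and.IH
  from node_value_and.prems show ?case
  proof cases
    case (node_value_and j' a' b' u' w')
    with hyps have "a' = a" "b' = b" by simp_all
    with node_value_and IH show ?thesis by metis
  qed (use hyps in simp_all)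
qed

definition relabel :: "nat \<Rightarrow> (nat \<Rightarrow> nat) \<Rightarrow> nat \<Rightarrow> nat" where
  "relabel n \<pi> k = (if k \<le> n then k else n + 1 + \<pi> (k - n - 1))"

text \<open>Label \<open>l\<close> belongs to gate \<open>inv \<pi> l\<close> of the circuit. The
  restriction to labels below the length puts the map into a finite extensional function space,
  which can be counted.\<close>

definition labelled_circuit :: "nat \<Rightarrow> circuit \<Rightarrow> (nat \<Rightarrow> nat) \<Rightarrow> nat \<Rightarrow> gate" where
  "labelled_circuit n C \<pi> = (\<lambda>l\<in>{..<length C}.
     (case C ! inv \<pi> l of Xor a b \<Rightarrow> Xor (relabel n \<pi> a) (relabel n \<pi> b)
        | And a b \<Rightarrow> And (relabel n \<pi> a) (relabel n \<pi> b)))"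

lemma relabel_less:
  assumes "\<pi> permutes {..<L}" "k < n + 1 + L"
  shows "relabel n \<pi> k < n + 1 + L"
  using assms permutes_in_image[OF assms(1), of "k - n - 1"] by (auto simp: relabel_def)

lemma node_fun_source: "k \<le> n \<Longrightarrow> node_fun n C k = source n k"
proof (induction C rule: rev_induct)
  case Nil
  show ?case by (simp add: node_fun_def source_def)
next
  case (snoc g C)
  then show ?case by (simp add: node_fun_snoc_old)
qed

lemma node_fun_gate:
  assumes "wf_circuit n C" "j < length C"
  shows "node_fun n C (n + 1 + j) =
    (case C ! j of Xor a b \<Rightarrow> node_fun n C a + node_fun n C b | And a b \<Rightarrow> node_fun n C a * node_fun n C b)"
  using assms
proof (induction C rule: rev_induct)
  case (snoc g C)
  have wf: "wf_circuit n C" "fst (gate_args g) < n + 1 + length C" "snd (gate_args g) < n + 1 + length C"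
    using snoc.prems(1) by (simp_all add: wf_circuit_snoc)
  show ?case
  proof (cases "j = length C")
    case True
    show ?thesis
    proof (cases g)
      case (Xor a b)
      have "node_fun n (C @ [g]) (n + 1 + j) = node_fun n C a + node_fun n C b"
        unfolding True node_fun_snoc_new Xor by (simp add: bfun_of_xor node_fun_def)
      with wf True Xor show ?thesis by (simp add: node_fun_snoc_old)
    next
      case (And a b)
      have "node_fun n (C @ [g]) (n + 1 + j) = node_fun n C a * node_fun n C b"
        unfolding True node_fun_snoc_new And by (simp add: bfun_of_and node_fun_def)
      with wf True And show ?thesis by (simp add: node_fun_snoc_old)
    qed
  next
    case False
    with snoc.prems(2) have j: "j < length C" by simp
    have args: "fst (gate_args (C ! j)) < n + 1 + length C" "snd (gate_args (C ! j)) < n + 1 + length C"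
      using wf(1) j unfolding wf_circuit_def by (meson add_less_cancel_left less_trans)+
    have old: "node_fun n (C @ [g]) (n + 1 + j) = node_fun n C (n + 1 + j)"
      using j by (intro node_fun_snoc_old) simp
    show ?thesis
      unfolding old snoc.IH[OF wf(1) j] nth_append_left[OF j]
      by (cases "C ! j") (use args in \<open>simp_all add: node_fun_snoc_old\<close>)
  qed
qed simp

lemma labelled_circuit_value:
  assumes C: "wf_circuit n C" and \<pi>: "\<pi> permutes {..<length C}"
  shows "k < n + 1 + length C \<Longrightarrow>
    node_value n (labelled_circuit n C \<pi>) (relabel n \<pi> k) (node_fun n C k)"
proof (induction k rule: less_induct)
  case (less k)
  show ?case
  proof (cases "k \<le> n")
    case True
    then show ?thesis by (simp add: relabel_def node_fun_source node_value_source)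
  next
    case False
    define j where "j = k - n - 1"
    have k: "k = n + 1 + j" and j: "j < length C" using False less.prems by (auto simp: j_def)
    have "\<pi> j < length C" using permutes_in_image[OF \<pi>, of j] j by simp
    then have D: "labelled_circuit n C \<pi> (\<pi> j) =
        (case C ! j of Xor a b \<Rightarrow> Xor (relabel n \<pi> a) (relabel n \<pi> b)
          | And a b \<Rightarrow> And (relabel n \<pi> a) (relabel n \<pi> b))"
      by (simp add: labelled_circuit_def permutes_inverses(2)[OF \<pi>])
    have rel: "relabel n \<pi> k = n + 1 + \<pi> j" by (simp add: relabel_def k)
    have args: "fst (gate_args (C ! j)) < k" "snd (gate_args (C ! j)) < k"
      using C j unfolding wf_circuit_def k by blast+
    have IH: "node_value n (labelled_circuit n C \<pi>) (relabel n \<pi> a) (node_fun n C a)" if "a < k" for a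
      using less.IH[OF that] less.prems that by simp
    have gate: "node_fun n C k = (case C ! j of Xor a b \<Rightarrow> node_fun n C a + node_fun n C b
        | And a b \<Rightarrow> node_fun n C a * node_fun n C b)"
      unfolding k by (rule node_fun_gate[OF C j])
    show ?thesis
    proof (cases "C ! j")
      case (Xor a b)
      with args have "a < k" "b < k" by simp_all
      from node_value_xor[OF _ IH[OF this(1)] IH[OF this(2)], of "\<pi> j"] show ?thesis
        unfolding rel gate using D Xor by simp
    next
      case (And a b)
      with args have "a < k" "b < k" by simp_all
      from node_value_and[OF _ IH[OF this(1)] IH[OF this(2)], of "\<pi> j"] show ?thesis
        unfolding rel gate using D And by simp
    qed
  qed
qed

definition reduced_funs :: "nat \<Rightarrow> nat \<Rightarrow> bfun set" where
  "reduced_funs n L = {f. \<exists>C. reduced_circuit n C \<and> length C = L \<and> f \<in> node_funs n C}"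

text \<open>Each of the L! labellings of a reduced circuit is a different labelled circuit.\<close>

lemma card_reduced_funs:
  "finite (reduced_funs n L)"
  "card (reduced_funs n L) * fact L \<le> (2 * (n + 1 + L)\<^sup>2) ^ L * (n + 1 + L)"
proof -
  define Q where "Q = n + 1 + L"
  define G where "G = (\<lambda>(a, b). Xor a b) ` ({..<Q} \<times> {..<Q}) \<union> (\<lambda>(a, b). And a b) ` ({..<Q} \<times> {..<Q})"
  have finG: "finite G" by (simp add: G_def)
  have cardG: "card G \<le> 2 * Q\<^sup>2"
  proof -
    have "card G \<le> card ({..<Q} \<times> {..<Q}) + card ({..<Q} \<times> {..<Q})"
      unfolding G_def by (intro order.trans[OF card_Un_le] add_mono card_image_le) auto
    then show ?thesis by (simp add: power2_eq_square)
  qed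
  have "\<forall>f\<in>reduced_funs n L. \<exists>C k. reduced_circuit n C \<and> length C = L \<and> k < n + 1 + L \<and> f = node_fun n C k"
    unfolding reduced_funs_def node_funs_def by blast
  then obtain C k where C: "\<And>f. f \<in> reduced_funs n L \<Longrightarrow> reduced_circuit n (C f)"
    "\<And>f. f \<in> reduced_funs n L \<Longrightarrow> length (C f) = L"
    "\<And>f. f \<in> reduced_funs n L \<Longrightarrow> k f < n + 1 + L"
    "\<And>f. f \<in> reduced_funs n L \<Longrightarrow> f = node_fun n (C f) (k f)"
    by metis
  have wf: "wf_circuit n (C f)" if "f \<in> reduced_funs n L" for f
    using C(1)[OF that] by (simp add: reduced_circuit_def)
  define perms where "perms = {\<pi>. \<pi> permutes {..<L}}"
  have perms: "finite perms" "card perms = fact L" "perms \<noteq> {}"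
    unfolding perms_def using permutes_id[of "{..<L}"]
    by (auto simp: card_permutations intro!: finite_permutations exI[of _ id])
  \<comment> \<open>A function is encoded by one chosen circuit under a labelling, together with the
    label of the node that computes it.\<close>
  define enc where "enc = (\<lambda>(f, \<pi>). (labelled_circuit n (C f) \<pi>, relabel n \<pi> (k f)))"
  have inj: "inj_on enc (reduced_funs n L \<times> perms)"
  proof (rule inj_onI)
    fix p q assume "p \<in> reduced_funs n L \<times> perms" "q \<in> reduced_funs n L \<times> perms" "enc p = enc q"
    then obtain f \<pi> g \<sigma> where pq: "p = (f, \<pi>)" "q = (g, \<sigma>)" and f: "f \<in> reduced_funs n L" and g: "g \<in> reduced_funs n L"
      and \<pi>: "\<pi> permutes {..<L}" and \<sigma>: "\<sigma> permutes {..<L}"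
      and D: "labelled_circuit n (C f) \<pi> = labelled_circuit n (C g) \<sigma>"
      and k: "relabel n \<pi> (k f) = relabel n \<sigma> (k g)"
      by (auto simp: perms_def enc_def)
    have vf: "node_value n (labelled_circuit n (C f) \<pi>) (relabel n \<pi> i) (node_fun n (C f) i)" if "i < n + 1 + L" for i
      using labelled_circuit_value[OF wf[OF f], of \<pi> i] that \<pi> C(2)[OF f] by simp
    have vg: "node_value n (labelled_circuit n (C f) \<pi>) (relabel n \<sigma> i) (node_fun n (C g) i)" if "i < n + 1 + L" for i
      unfolding D using labelled_circuit_value[OF wf[OF g], of \<sigma> i] that \<sigma> C(2)[OF g] by simp
    have "f = g"
      using node_value_unique[OF vf[OF C(3)[OF f]] vg[OF C(3)[OF g], folded k]] C(4)[OF f] C(4)[OF g] by simp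
    have "\<pi> l = \<sigma> l" if "l < L" for l
    proof -
      \<comment> \<open>Gate \<open>i\<close> has under \<sigma> the label that gate
        \<open>l\<close> has under \<pi>. Since f = g, both are gates of the same circuit and
        compute the value at this label, so they coincide in a reduced circuit.\<close>
      define i where "i = inv \<sigma> (\<pi> l)"
      have "\<pi> l < L" using permutes_in_image[OF \<pi>, of l] that by simp
      then have i: "i < L" "\<sigma> i = \<pi> l"
        using permutes_in_image[OF permutes_inv[OF \<sigma>], of "\<pi> l"] permutes_inverses(1)[OF \<sigma>] by (simp_all add: i_def)
      have "relabel n \<pi> (n + 1 + l) = relabel n \<sigma> (n + 1 + i)" by (simp add: relabel_def i)
      then have "node_fun n (C f) (n + 1 + l) = node_fun n (C f) (n + 1 + i)"
        using node_value_unique[OF vf[of "n + 1 + l"], of "node_fun n (C g) (n + 1 + i)"]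
          vg[of "n + 1 + i"] that i(1) \<open>f = g\<close> by simp
      with C(1)[OF f] C(2)[OF f] that i(1) have "l = i"
        unfolding reduced_circuit_def inj_on_def by blast
      with i show ?thesis by simp
    qed
    then have "\<pi> = \<sigma>" using \<pi> \<sigma> by (metis lessThan_iff permutes_not_in ext)
    with \<open>f = g\<close> pq show "p = q" by simp
  qed
  have img: "enc ` (reduced_funs n L \<times> perms) \<subseteq> ({..<L} \<rightarrow>\<^sub>E G) \<times> {..<Q}"
  proof
    fix z assume "z \<in> enc ` (reduced_funs n L \<times> perms)"
    then obtain f \<pi> where f: "f \<in> reduced_funs n L" and \<pi>: "\<pi> permutes {..<L}"
      and z: "z = (labelled_circuit n (C f) \<pi>, relabel n \<pi> (k f))"
      by (auto simp: perms_def enc_def)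
    have "labelled_circuit n (C f) \<pi> l \<in> G" if "l < L" for l
    proof -
      define j where "j = inv \<pi> l"
      have j: "j < L" using permutes_in_image[OF permutes_inv[OF \<pi>], of l] that by (simp add: j_def)
      then have "fst (gate_args (C f ! j)) < n + 1 + j" "snd (gate_args (C f ! j)) < n + 1 + j"
        using wf[OF f] C(2)[OF f] by (simp_all add: wf_circuit_def)
      then have "fst (gate_args (C f ! j)) < n + 1 + L" "snd (gate_args (C f ! j)) < n + 1 + L"
        using j by simp_all
      then show ?thesis using that C(2)[OF f] relabel_less[OF \<pi>, of _ n]
        by (cases "C f ! j") (auto simp: labelled_circuit_def G_def Q_def j_def[symmetric])
    qed
    then have "labelled_circuit n (C f) \<pi> \<in> {..<L} \<rightarrow>\<^sub>E G"
      using C(2)[OF f] by (auto simp: labelled_circuit_def PiE_iff)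
    then show "z \<in> ({..<L} \<rightarrow>\<^sub>E G) \<times> {..<Q}"
      using relabel_less[OF \<pi> C(3)[OF f]] z by (simp add: Q_def)
  qed
  have fin: "finite (({..<L} \<rightarrow>\<^sub>E G) \<times> {..<Q})" using finG by (simp add: finite_PiE)
  have "finite (reduced_funs n L \<times> perms)" using inj_on_finite[OF inj img fin] .
  then show "finite (reduced_funs n L)" using perms(3) by (rule finite_cartesian_productD1)
  have "card (reduced_funs n L \<times> perms) \<le> card (({..<L} \<rightarrow>\<^sub>E G) \<times> {..<Q})"
    using card_inj_on_le[OF inj img fin] .
  also have "\<dots> = card G ^ L * Q" by (simp add: card_cartesian_product card_PiE)
  also have "\<dots> \<le> (2 * Q\<^sup>2) ^ L * Q" using cardG by (intro mult_right_mono power_mono) auto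
  finally show "card (reduced_funs n L) * fact L \<le> (2 * (n + 1 + L)\<^sup>2) ^ L * (n + 1 + L)"
    using perms(2) by (simp add: card_cartesian_product Q_def)
qed

section \<open>Number of functions of bounded total complexity\<close>

definition cheap_funs :: "nat \<Rightarrow> nat \<Rightarrow> bfun set" where
  "cheap_funs n L = {f. \<exists>S k m. computes n S k m \<and> k \<le> L \<and> f \<in> S}"

text \<open>Consecutive terms have the ratio X / (i + 1), which is at least 1 up to
  \<open>L\<close>. This bounds the count for every smaller size by the one for size
  \<open>L\<close>.\<close>

lemma power_div_fact_mono:
  assumes "i \<le> L" "real L \<le> X"
  shows "X ^ i / fact i \<le> X ^ L / fact L"
  using assms
proof (induction L)
  case (Suc L)
  show ?case
  proof (cases "i = Suc L")
    case False
    with Suc have "X ^ i / fact i \<le> X ^ L / fact L" by simp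
    also have "\<dots> = 1 * (X ^ L / fact L)" by simp
    also have "\<dots> \<le> (X / Suc L) * (X ^ L / fact L)"
      using Suc.prems(2) by (intro mult_right_mono divide_nonneg_nonneg zero_le_power) (auto simp: field_simps)
    also have "\<dots> = X ^ Suc L / fact (Suc L)" by simp
    finally show ?thesis .
  qed simp
qed simp

text \<open>A single term of the exponential series; at x = k it reads k^k / k! \<le> e^k, which is
  all of Stirling's formula that the count requires.\<close>

lemma power_div_fact_le_exp:
  assumes "(x::real) \<ge> 0"
  shows "x ^ k / fact k \<le> exp x"
proof -
  have "sum (\<lambda>i. x ^ i /\<^sub>R fact i) {k} \<le> suminf (\<lambda>i. x ^ i /\<^sub>R fact i)"
    using assms by (intro sum_le_suminf summable_exp_generic) auto
  then show ?thesis by (simp add: exp_def divide_inverse mult.commute)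
qed

text \<open>Since \<open>n + 1 \<le> L\<close>, there are at most 2 L nodes and hence 2 (2 L)^2 = 8
  L^2 possible gates. Division by L! turns one factor L^L into at most e^L \<le> 3^L, and 8 * 3 =
  24. The factor \<open>4 * real L ^ 2\<close> pays for the L + 1 sizes and for the choice of the
  output node.\<close>

lemma card_cheap_funs:
  assumes "n + 1 \<le> L"
  shows "finite (cheap_funs n L)" "real (card (cheap_funs n L)) \<le> 4 * real L ^ 2 * (24 * real L) ^ L"
proof -
  define Q where "Q = n + 1 + L"
  define X where "X = 2 * (real Q)\<^sup>2"
  have L: "L \<ge> 1" using assms by simp
  have Q: "Q \<le> 2 * L" "L \<le> Q" "Q \<ge> 1" using assms by (simp_all add: Q_def)
  have "real Q * 1 \<le> real Q * real Q" using Q by (intro mult_left_mono) auto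
  moreover have "real L \<le> real Q" using Q by simp
  ultimately have LX: "real L \<le> X" unfolding X_def power2_eq_square by linarith
  have sub: "cheap_funs n L \<subseteq> (\<Union>i\<le>L. reduced_funs n i)"
  proof
    fix f assume "f \<in> cheap_funs n L"
    then obtain S k m where S: "computes n S k m" "k \<le> L" "f \<in> S" by (auto simp: cheap_funs_def)
    from computes_reduced_circuit[OF S(1)] S obtain C where "reduced_circuit n C" "length C \<le> L" "f \<in> node_funs n C"
      by auto
    then show "f \<in> (\<Union>i\<le>L. reduced_funs n i)" by (auto simp: reduced_funs_def)
  qed
  have fin: "finite (\<Union>i\<le>L. reduced_funs n i)" using card_reduced_funs(1) by blast
  with sub show "finite (cheap_funs n L)" by (rule finite_subset)
  have each: "real (card (reduced_funs n i)) \<le> real Q * (X ^ L / fact L)" if "i \<le> L" for i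
  proof -
    have "real (card (reduced_funs n i) * fact i) \<le> real ((2 * (n + 1 + i)\<^sup>2) ^ i * (n + 1 + i))"
      using card_reduced_funs(2)[of n i] by (simp only: of_nat_le_iff)
    also have "\<dots> = (2 * (real (n + 1 + i))\<^sup>2) ^ i * real (n + 1 + i)"
      by (simp only: of_nat_mult of_nat_power of_nat_numeral)
    also have "\<dots> \<le> X ^ i * real Q"
      unfolding X_def using that by (intro mult_mono power_mono mult_left_mono) (auto simp: Q_def)
    finally have "real (card (reduced_funs n i)) \<le> real Q * (X ^ i / fact i)"
      by (simp add: field_simps)
    also have "\<dots> \<le> real Q * (X ^ L / fact L)"
      by (intro mult_left_mono power_div_fact_mono that LX) auto
    finally show ?thesis .
  qed
  have pow: "X ^ L / fact L \<le> (24 * real L) ^ L"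
  proof -
    have "X \<le> 2 * (2 * real L)\<^sup>2"
      unfolding X_def using Q by (intro mult_left_mono power_mono) auto
    then have "X ^ L \<le> (8 * real L * real L) ^ L"
      by (intro power_mono) (auto simp: X_def power2_eq_square)
    then have "X ^ L / fact L \<le> (8 * real L) ^ L * (real L ^ L / fact L)"
      by (simp add: power_mult_distrib divide_right_mono)
    also have "\<dots> \<le> (8 * real L) ^ L * exp (real L)"
      by (intro mult_left_mono power_div_fact_le_exp) auto
    also have "exp (real L) = exp 1 ^ L" using exp_of_nat_mult[of L "1::real"] by simp
    also have "(8 * real L) ^ L * exp 1 ^ L \<le> (8 * real L) ^ L * 3 ^ L"
      by (intro mult_left_mono power_mono exp_le) auto
    also have "\<dots> = (8 * real L * 3) ^ L" by (simp only: power_mult_distrib)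
    also have "8 * real L * 3 = 24 * real L" by simp
    finally show ?thesis .
  qed
  have "card (cheap_funs n L) \<le> card (\<Union>i\<le>L. reduced_funs n i)" by (rule card_mono[OF fin sub])
  also have "\<dots> \<le> (\<Sum>i\<le>L. card (reduced_funs n i))" by (intro card_UN_le) simp
  finally have "real (card (cheap_funs n L)) \<le> (\<Sum>i\<le>L. real (card (reduced_funs n i)))"
    by (metis of_nat_le_iff of_nat_sum)
  also have "\<dots> \<le> (\<Sum>i\<le>L. real Q * (X ^ L / fact L))" using each by (intro sum_mono) auto
  also have "\<dots> = real (Suc L) * (real Q * (X ^ L / fact L))" by simp
  also have "\<dots> \<le> (2 * real L) * ((2 * real L) * (24 * real L) ^ L)"
    using Q L pow by (intro mult_mono) (auto simp: X_def)
  also have "\<dots> = 4 * real L ^ 2 * (24 * real L) ^ L" by (simp add: power2_eq_square)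
  finally show "real (card (cheap_funs n L)) \<le> 4 * real L ^ 2 * (24 * real L) ^ L" .
qed

section \<open>A large family of functions of small multiplicative complexity\<close>

text \<open>Level l consists of w conjunctions. Both arguments of each of them contain an arbitrary linear
  combination of all gates of lower levels, selected by the parameter sets A and B; the fresh variables
  al l and be l make it possible to read these combinations off the function.\<close>

function level_gate :: "(nat \<times> nat \<times> nat \<times> nat) set \<Rightarrow> (nat \<times> nat \<times> nat \<times> nat) set \<Rightarrow> nat \<Rightarrow>
    (nat \<Rightarrow> bit) \<Rightarrow> (nat \<Rightarrow> bit) \<Rightarrow> (nat \<Rightarrow> bit) \<Rightarrow> nat \<Rightarrow> nat \<Rightarrow> bit" where
  "level_gate A B w al be x l j =
     (al l + (\<Sum>l'<l. \<Sum>j'<w. of_bool ((l, j, l', j') \<in> A) * level_gate A B w al be x l' j')) *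
     (be l + x j + (\<Sum>l'<l. \<Sum>j'<w. of_bool ((l, j, l', j') \<in> B) * level_gate A B w al be x l' j'))"
  by auto
termination by (relation "measure (\<lambda>(A, B, w, al, be, x, l, j). l)") auto

declare level_gate.simps [simp del]

section \<open>Independence of the gates and recovery of the parameters\<close>

lemma level_gate_cong:
  assumes "\<And>i. i \<le> l \<Longrightarrow> al i = al' i" "\<And>i. i \<le> l \<Longrightarrow> be i = be' i"
    and "\<And>i. i < w \<Longrightarrow> x i = x' i" "j < w"
    and "\<And>a b c d. a \<le> l \<Longrightarrow> b < w \<Longrightarrow> c < a \<Longrightarrow> d < w \<Longrightarrow> (a, b, c, d) \<in> A \<longleftrightarrow> (a, b, c, d) \<in> A'"
    and "\<And>a b c d. a \<le> l \<Longrightarrow> b < w \<Longrightarrow> c < a \<Longrightarrow> d < w \<Longrightarrow> (a, b, c, d) \<in> B \<longleftrightarrow> (a, b, c, d) \<in> B'"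
  shows "level_gate A B w al be x l j = level_gate A' B' w al' be' x' l j"
  using assms
proof (induction l arbitrary: j rule: less_induct)
  case (less l)
  have "level_gate A B w al be x l' j' = level_gate A' B' w al' be' x' l' j'" if "l' < l" "j' < w" for l' j'
    by (rule less.IH) (use less.prems that in auto)
  moreover have "(l, j, l', j') \<in> A \<longleftrightarrow> (l, j, l', j') \<in> A'" "(l, j, l', j') \<in> B \<longleftrightarrow> (l, j, l', j') \<in> B'"
    if "l' < l" "j' < w" for l' j'
    using less.prems(4) less.prems(5,6)[of l j l' j'] that by simp_all
  ultimately show ?case
    unfolding level_gate.simps[of _ _ _ _ _ _ l] using less.prems
    by (intro arg_cong2[where f = "(*)"] arg_cong2[where f = "(+)"] sum.cong) auto
qed

lemma level_gate_eq_0: "(\<And>i. i \<le> l \<Longrightarrow> al i = 0) \<Longrightarrow> level_gate A B w al be x l j = 0"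
proof (induction l arbitrary: j rule: less_induct)
  case (less l)
  then have "level_gate A B w al be x l' j' = 0" if "l' < l" for l' j' using that by simp
  with less.prems show ?case by (subst level_gate.simps) simp
qed

lemma level_gates_independent:
  assumes "\<And>al be x. (\<Sum>l<t. \<Sum>j<w. c l j * level_gate A B w al be x l j) = 0" "l < t" "j < w"
  shows "c l j = 0"
  using assms
proof (induction t arbitrary: l j)
  case (Suc t)
  have top: "c t j = 0" if "j < w" for j
  proof -
    define al :: "nat \<Rightarrow> bit" where "al = (\<lambda>i. of_bool (i = t))"
    define x :: "nat \<Rightarrow> bit" where "x = (\<lambda>i. of_bool (i = j))"
    have low: "level_gate A B w al (\<lambda>_. 0) x l i = 0" if "l < t" for l i
      using that by (intro level_gate_eq_0) (auto simp: al_def)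
    then have "level_gate A B w al (\<lambda>_. 0) x t i = x i" for i
      by (subst level_gate.simps) (simp add: al_def)
    with low Suc.prems(1)[of al "\<lambda>_. 0" x] have "(\<Sum>i<w. c t i * x i) = 0" by simp
    also have "(\<Sum>i<w. c t i * x i) = (\<Sum>i<w. if i = j then c t i else 0)"
      by (intro sum.cong) (auto simp: x_def)
    also have "\<dots> = c t j" using that by simp
    finally show ?thesis .
  qed
  show ?case
  proof (cases "l = t")
    case False
    have "(\<Sum>l<t. \<Sum>j<w. c l j * level_gate A B w al be x l j) = 0" for al be x
      using Suc.prems(1)[of al be x] top by simp
    from Suc.IH[OF this] False Suc.prems show ?thesis by simp
  qed (use top Suc.prems in simp)
qed simp

text \<open>Comparison of coefficients in a and b: b has the coefficient p, a has y + q, and the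
  constant term then determines h.\<close>

lemma bit_eq_if_products_eq:
  fixes h h' p p' q q' y :: bit
  assumes "\<And>a b. h + (a + p) * (b + y + q) = h' + (a + p') * (b + y + q')"
  shows "h = h' \<and> p = p' \<and> q = q'"
  using assms[of 0 0] assms[of 0 1] assms[of 1 0] assms[of 1 1]
  by (cases h; cases h'; cases p; cases p'; cases q; cases q'; cases y; simp)

lemma bit_add_eq_0_iff: "(a::bit) + b = 0 \<longleftrightarrow> a = b"
  by (cases a; cases b; simp)

text \<open>The variables \<open>al t\<close> and \<open>be t\<close> occur in no level below
  \<open>t\<close>, so they vary freely while the lower gates stay fixed; this separates the sum of
  the lower levels from the two linear forms of the top level. Induction identifies the lower
  parameters and hence the lower gates, and the independence of these gates identifies the top
  parameters.\<close>

lemma level_parameters_unique: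
  assumes "\<And>al be x j. j < w \<Longrightarrow>
      (\<Sum>l<t. level_gate A B w al be x l j) = (\<Sum>l<t. level_gate A' B' w al be x l j)"
    and "l < t" "j < w" "l' < l" "j' < w"
  shows "((l, j, l', j') \<in> A \<longleftrightarrow> (l, j, l', j') \<in> A') \<and> ((l, j, l', j') \<in> B \<longleftrightarrow> (l, j, l', j') \<in> B')"
  using assms
proof (induction t arbitrary: l j l' j')
  case (Suc t)
  define form where "form = (\<lambda>A B (P :: (nat \<times> nat \<times> nat \<times> nat) set) al be x j. \<Sum>l'<t. \<Sum>j'<w. of_bool ((t, j, l', j') \<in> P) * level_gate A B w al be x l' j')"
  define low where "low = (\<lambda>A B al be x j. \<Sum>l<t. level_gate A B w al be x l j)"
  have low_eq: "(\<Sum>l<t. level_gate A B w al be x l j) = low A B al be x j" for A B al be x j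
    by (simp add: low_def)
  have gate: "level_gate A B w al be x t j =
      (al t + form A B A al be x j) * (be t + x j + form A B B al be x j)" for A B al be x j
    unfolding form_def by (rule level_gate.simps)
  have upd: "level_gate A B w (al(t := a)) (be(t := b)) x l j = level_gate A B w al be x l j"
    if "l < t" "j < w" for A B al be x l j a b
    using that by (intro level_gate_cong) auto
  have form_upd: "form A B P (al(t := a)) (be(t := b)) x j = form A B P al be x j" for A B P al be x j a b
    unfolding form_def by (intro sum.cong refl) (simp add: upd)
  have low_upd: "low A B (al(t := a)) (be(t := b)) x j = low A B al be x j" if "j < w" for A B al be x j a b
    unfolding low_def using that by (intro sum.cong refl) (simp add: upd)
  have split: "low A B al be x j = low A' B' al be x j \<and> form A B A al be x j = form A' B' A' al be x j \<and>
      form A B B al be x j = form A' B' B' al be x j" if "j < w" for al be x j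
  proof (rule bit_eq_if_products_eq)
    fix a b :: bit
    from Suc.prems(1)[OF that, of "al(t := a)" "be(t := b)" x]
    show "low A B al be x j + (a + form A B A al be x j) * (b + x j + form A B B al be x j) =
        low A' B' al be x j + (a + form A' B' A' al be x j) * (b + x j + form A' B' B' al be x j)"
      unfolding sum.lessThan_Suc gate low_eq form_upd low_upd[OF that] by simp
  qed
  then have IH: "((l, j, l', j') \<in> A \<longleftrightarrow> (l, j, l', j') \<in> A') \<and> ((l, j, l', j') \<in> B \<longleftrightarrow> (l, j, l', j') \<in> B')"
    if "l < t" "j < w" "l' < l" "j' < w" for l j l' j'
    using that unfolding low_def by (intro Suc.IH) auto
  have same: "level_gate A' B' w al be x l j = level_gate A B w al be x l j" if "l < t" "j < w" for al be x l j
    using that IH by (intro level_gate_cong) auto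
  have top: "(t, j, l', j') \<in> P \<longleftrightarrow> (t, j, l', j') \<in> P'"
    if eq: "\<And>al be x. form A B P al be x j = form A' B' P' al be x j" and "l' < t" "j' < w" for P P' j l' j'
  proof -
    \<comment> \<open>These bits mark where the two selections differ; they are the coefficients of
      a linear relation between independent gates.\<close>
    define c :: "nat \<Rightarrow> nat \<Rightarrow> bit" where
      "c = (\<lambda>l' j'. of_bool ((t, j, l', j') \<in> P) + of_bool ((t, j, l', j') \<in> P'))"
    have "(\<Sum>l'<t. \<Sum>j'<w. c l' j' * level_gate A B w al be x l' j') = 0" for al be x
    proof -
      have "form A' B' P' al be x j = form A B P' al be x j"
        unfolding form_def by (intro sum.cong refl) (simp add: same)
      with eq have "form A B P al be x j + form A B P' al be x j = 0" by simp
      then show ?thesis unfolding form_def c_def by (simp only: distrib_right sum.distrib)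
    qed
    from level_gates_independent[OF this that(2,3)] have "c l' j' = 0" .
    then show ?thesis unfolding c_def bit_add_eq_0_iff by (auto simp: of_bool_def split: if_splits)
  qed
  show ?case
  proof (cases "l = t")
    case True
    then show ?thesis using Suc.prems top[of A j A' l' j'] top[of B j B' l' j'] split by simp
  next
    case False
    then show ?thesis using Suc.prems by (intro IH) auto
  qed
qed simp

text \<open>Four groups of \<open>w\<close> variables serve as al, be, x and as selectors; the
  offset 1 skips the constant node. One selector per column packs the \<open>w\<close> column sums
  into a single function at the price of \<open>w\<close> further conjunctions.\<close>

definition hard_fun :: "nat \<Rightarrow> nat \<Rightarrow> (nat \<times> nat \<times> nat \<times> nat) set \<Rightarrow> (nat \<times> nat \<times> nat \<times> nat) set \<Rightarrow> bfun" where
  "hard_fun n w A B = (\<lambda>xs. \<Sum>j<w. source n (1 + 3 * w + j) xs *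
     (\<Sum>l<w. level_gate A B w (\<lambda>i. source n (1 + i) xs) (\<lambda>i. source n (1 + w + i) xs)
        (\<lambda>i. source n (1 + 2 * w + i) xs) l j))"

definition parameters :: "nat \<Rightarrow> (nat \<times> nat \<times> nat \<times> nat) set" where
  "parameters w = (SIGMA l:{..<w}. {..<w} \<times> {..<l} \<times> {..<w})"

lemma finite_parameters [simp]: "finite (parameters w)"
  by (auto simp: parameters_def)

lemma card_parameters: "2 * card (parameters w) = w ^ 3 * (w - 1)"
proof -
  have "card (parameters w) = (\<Sum>l<w. w * (l * w))"
    unfolding parameters_def by (subst card_SigmaI) auto
  also have "\<dots> = w * w * (\<Sum>l<w. l)" by (simp add: sum_distrib_left ac_simps)
  finally have "2 * card (parameters w) = w * w * (2 * (\<Sum>l<w. l))" by simp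
  also have "2 * (\<Sum>l<w. l) = w * (w - 1)" by (induction w) (auto simp: algebra_simps)
  finally show ?thesis by (simp add: power3_eq_cube)
qed

text \<open>Setting the selectors to the \<open>j\<close>-th unit vector and the other three groups
  arbitrarily turns the function into column sum \<open>j\<close>; the column sums determine the
  parameters.\<close>

lemma inj_on_hard_fun:
  assumes n: "4 * w \<le> n"
  shows "inj_on (\<lambda>(A, B). hard_fun n w A B) (Pow (parameters w) \<times> Pow (parameters w))"
proof (rule inj_onI, clarify)
  fix A B A' B' assume sub: "A \<subseteq> parameters w" "B \<subseteq> parameters w" "A' \<subseteq> parameters w" "B' \<subseteq> parameters w"
    and eq: "hard_fun n w A B = hard_fun n w A' B'"
  have sums: "(\<Sum>l<w. level_gate A B w al be x l j) = (\<Sum>l<w. level_gate A' B' w al be x l j)"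
    if j: "j < w" for al be x j
  proof -
    define b where "b = (\<lambda>i. if i < w then al i = 1 else if i < 2 * w then be (i - w) = 1
      else if i < 3 * w then x (i - 2 * w) = 1 else i = 3 * w + j)"
    define xs where "xs = map b [0..<n]"
    have src: "source n (1 + i) xs = of_bool (b i)" if "i < n" for i
      using that by (simp add: source_def bfun_of_def xs_def)
    have bit: "of_bool (z = 1) = z" for z :: bit by (cases z) auto
    have env: "source n (1 + i) xs = al i" "source n (1 + w + i) xs = be i"
      "source n (1 + 2 * w + i) xs = x i" "source n (1 + 3 * w + i) xs = of_bool (i = j)" if "i < w" for i
      using that n src[of i] src[of "w + i"] src[of "2 * w + i"] src[of "3 * w + i"]
      by (simp_all add: b_def bit)
    have "hard_fun n w A B xs = (\<Sum>l<w. level_gate A B w al be x l j)" for A B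
    proof -
      have "hard_fun n w A B xs = (\<Sum>i<w. if i = j then (\<Sum>l<w. level_gate A B w al be x l i) else 0)"
        unfolding hard_fun_def
      proof (rule sum.cong[OF refl])
        fix i assume "i \<in> {..<w}"
        then have i: "i < w" by simp
        have "level_gate A B w (\<lambda>i. source n (1 + i) xs) (\<lambda>i. source n (1 + w + i) xs)
            (\<lambda>i. source n (1 + 2 * w + i) xs) l i = level_gate A B w al be x l i" if "l < w" for l
          using that env i by (intro level_gate_cong) auto
        then show "source n (1 + 3 * w + i) xs * (\<Sum>l<w. level_gate A B w (\<lambda>i. source n (1 + i) xs)
            (\<lambda>i. source n (1 + w + i) xs) (\<lambda>i. source n (1 + 2 * w + i) xs) l i) =
            (if i = j then (\<Sum>l<w. level_gate A B w al be x l i) else 0)"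
          unfolding env(4)[OF i] by simp
      qed
      also have "\<dots> = (\<Sum>l<w. level_gate A B w al be x l j)" using j by simp
      finally show ?thesis .
    qed
    with eq show ?thesis by metis
  qed
  have "p \<in> A \<longleftrightarrow> p \<in> A'" "p \<in> B \<longleftrightarrow> p \<in> B'" if "p \<in> parameters w" for p
    using that level_parameters_unique[OF sums] by (auto simp: parameters_def)
  with sub show "A = A' \<and> B = B'" by blast
qed

section \<open>Multiplicative complexity of the family, with XOR gates uncounted\<close>

definition and_reachable :: "nat \<Rightarrow> nat \<Rightarrow> bfun set \<Rightarrow> bool" where
  "and_reachable n m S \<longleftrightarrow> (\<exists>k. reachable n k m S)"

lemma and_reachable_mono:
  "and_reachable n m S \<Longrightarrow> m \<le> m' \<Longrightarrow> T \<subseteq> insert 0 S \<Longrightarrow> and_reachable n m' T"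
  unfolding and_reachable_def using reachable_mono by blast

lemma and_reachable_sum:
  "and_reachable n m S \<Longrightarrow> finite T \<Longrightarrow> v ` T \<subseteq> insert 0 S \<Longrightarrow> and_reachable n m (insert (sum v T) S)"
  unfolding and_reachable_def using reachable_sum by blast

lemma and_reachable_xor:
  "and_reachable n m S \<Longrightarrow> u \<in> insert 0 S \<Longrightarrow> v \<in> insert 0 S \<Longrightarrow> and_reachable n m (insert (u + v) S)"
  unfolding and_reachable_def using reachable_xor by blast

lemma and_reachable_and:
  "and_reachable n m S \<Longrightarrow> u \<in> insert 0 S \<Longrightarrow> v \<in> insert 0 S \<Longrightarrow> and_reachable n (Suc m) (insert (u * v) S)"
  unfolding and_reachable_def using reachable_and by blast

lemma sum_bfun_apply: "sum F T xs = (\<Sum>p\<in>T. F p xs)" for F :: "'a \<Rightarrow> bfun"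
  by (induction T rule: infinite_finite_induct) (simp_all add: plus_fun_apply zero_fun_apply)

text \<open>Sums are free here, so each of the \<open>w * w\<close> gates costs one conjunction once
  the lower levels are present, and each selector costs one more.\<close>

lemma and_reachable_hard_fun:
  assumes n: "4 * w \<le> n"
  shows "and_reachable n (w * w + w) {hard_fun n w A B}"
proof -
  define g where "g = (\<lambda>l j xs. level_gate A B w (\<lambda>i. source n (1 + i) xs) (\<lambda>i. source n (1 + w + i) xs)
        (\<lambda>i. source n (1 + 2 * w + i) xs) l j)"
  define src where "src = source n ` {..n}"
  have src: "source n i \<in> src" if "i \<le> n" for i using that by (simp add: src_def)
  \<comment> \<open>The 0-1 coefficients of \<open>level_gate\<close> become index sets, the form in
    which \<open>and_reachable_sum\<close> takes a sum.\<close>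
  define sel where "sel = (\<lambda>(P :: (nat \<times> nat \<times> nat \<times> nat) set) l j. {p \<in> {..<l} \<times> {..<w}. (l, j, p) \<in> P})"
  have sel_sum: "(\<Sum>l'<l. \<Sum>j'<w. of_bool ((l, j, l', j') \<in> P) * g l' j' xs) = sum (\<lambda>(l, j). g l j) (sel P l j) xs"
    for P l j xs
  proof -
    have "(\<Sum>l'<l. \<Sum>j'<w. of_bool ((l, j, l', j') \<in> P) * g l' j' xs) =
        (\<Sum>p\<in>{..<l} \<times> {..<w}. if (l, j, p) \<in> P then (case p of (l', j') \<Rightarrow> g l' j') xs else 0)"
      unfolding sum.cartesian_product by (intro sum.cong) auto
    also have "\<dots> = (\<Sum>p\<in>sel P l j. (case p of (l', j') \<Rightarrow> g l' j') xs)"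
      unfolding sel_def by (rule sum.inter_filter[symmetric]) auto
    finally show ?thesis by (simp only: sum_bfun_apply)
  qed
  have g_eq: "g l j = (source n (1 + l) + sum (\<lambda>(l, j). g l j) (sel A l j)) *
      ((source n (1 + w + l) + source n (1 + 2 * w + j)) + sum (\<lambda>(l, j). g l j) (sel B l j))" for l j
  proof
    fix xs
    have "g l j xs = (source n (1 + l) xs + (\<Sum>l'<l. \<Sum>j'<w. of_bool ((l, j, l', j') \<in> A) * g l' j' xs)) *
     (source n (1 + w + l) xs + source n (1 + 2 * w + j) xs + (\<Sum>l'<l. \<Sum>j'<w. of_bool ((l, j, l', j') \<in> B) * g l' j' xs))"
      unfolding g_def by (rule level_gate.simps)
    then show "g l j xs = ((source n (1 + l) + sum (\<lambda>(l, j). g l j) (sel A l j)) *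
      ((source n (1 + w + l) + source n (1 + 2 * w + j)) + sum (\<lambda>(l, j). g l j) (sel B l j))) xs"
      unfolding sel_sum by (simp only: plus_fun_apply times_fun_apply)
  qed
  have step: "and_reachable n (Suc m) (insert (g l j) S)"
    if "and_reachable n m S" "src \<subseteq> S" "l < w" "j < w" "(\<lambda>(l, j). g l j) ` ({..<l} \<times> {..<w}) \<subseteq> S" for m S l j
  proof -
    let ?a = "sum (\<lambda>(l, j). g l j) (sel A l j)" and ?b = "sum (\<lambda>(l, j). g l j) (sel B l j)"
    let ?p = "source n (1 + l)" and ?q = "source n (1 + w + l)" and ?r = "source n (1 + 2 * w + j)"
    have s: "?p \<in> S" "?q \<in> S" "?r \<in> S" using n that(2-4) by (auto intro!: subsetD[OF that(2)] src)
    have im: "(\<lambda>(l, j). g l j) ` sel P l j \<subseteq> S" for P using that(5) unfolding sel_def by blast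
    have fin: "finite (sel P l j)" for P unfolding sel_def by simp
    have "and_reachable n m (insert ?a S)"
      by (rule and_reachable_sum[OF that(1) fin]) (use im in blast)
    then have "and_reachable n m (insert ?b (insert ?a S))"
      by (rule and_reachable_sum[OF _ fin]) (use im in blast)
    then have "and_reachable n m (insert (?p + ?a) (insert ?b (insert ?a S)))"
      by (rule and_reachable_xor) (use s in blast)+
    then have "and_reachable n m (insert (?q + ?r) (insert (?p + ?a) (insert ?b (insert ?a S))))"
      by (rule and_reachable_xor) (use s in blast)+
    then have "and_reachable n m (insert ((?q + ?r) + ?b) (insert (?q + ?r) (insert (?p + ?a) (insert ?b (insert ?a S)))))"
      by (rule and_reachable_xor) blast+
    then have "and_reachable n (Suc m) (insert ((?p + ?a) * ((?q + ?r) + ?b)) (insert ((?q + ?r) + ?b)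
        (insert (?q + ?r) (insert (?p + ?a) (insert ?b (insert ?a S))))))"
      by (rule and_reachable_and) blast+
    then show ?thesis unfolding g_eq[of l j] by (rule and_reachable_mono) blast+
  qed
  have level: "and_reachable n (m + i) (S \<union> g l ` {..<i})"
    if "i \<le> w" "and_reachable n m S" "src \<subseteq> S" "l < w" "(\<lambda>(l, j). g l j) ` ({..<l} \<times> {..<w}) \<subseteq> S" for i m S l
    using that(1)
  proof (induction i)
    case 0
    show ?case using that(2) by simp
  next
    case (Suc i)
    then have "and_reachable n (Suc (m + i)) (insert (g l i) (S \<union> g l ` {..<i}))"
      using that by (intro step) auto
    then show ?case by (simp add: lessThan_Suc)
  qed
  have levels: "and_reachable n (t * w) (src \<union> (\<lambda>(l, j). g l j) ` ({..<t} \<times> {..<w}))" if "t \<le> w" for t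
    using that
  proof (induction t)
    case 0
    have "and_reachable n 0 src" unfolding and_reachable_def src_def using reachable_source by blast
    then show ?case by simp
  next
    case (Suc t)
    then have "and_reachable n (t * w + w) (src \<union> (\<lambda>(l, j). g l j) ` ({..<t} \<times> {..<w}) \<union> g t ` {..<w})"
      by (intro level) auto
    then show ?case by (rule and_reachable_mono) (auto simp: less_Suc_eq)
  qed
  define S0 where "S0 = src \<union> (\<lambda>(l, j). g l j) ` ({..<w} \<times> {..<w})"
  define out where "out = (\<lambda>j. source n (1 + 3 * w + j) * (\<Sum>l<w. g l j))"
  have outs: "and_reachable n (w * w + i) (S0 \<union> out ` {..<i})" if "i \<le> w" for i
    using that
  proof (induction i)
    case 0
    show ?case using levels[of w] by (simp add: S0_def)
  next
    case (Suc i)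
    let ?S = "S0 \<union> out ` {..<i}"
    have im: "(\<lambda>l. g l i) ` {..<w} \<subseteq> insert 0 ?S" using Suc.prems by (auto simp: S0_def)
    have "source n (1 + 3 * w + i) \<in> ?S" using n Suc.prems src[of "1 + 3 * w + i"] by (auto simp: S0_def)
    moreover have "and_reachable n (w * w + i) (insert (\<Sum>l<w. g l i) ?S)"
      using Suc by (intro and_reachable_sum im) auto
    ultimately have "and_reachable n (Suc (w * w + i)) (insert (out i) (insert (\<Sum>l<w. g l i) ?S))"
      unfolding out_def by (intro and_reachable_and) blast+
    then show ?case by (rule and_reachable_mono) (auto simp: lessThan_Suc)
  qed
  have "and_reachable n (w * w + w) (insert (\<Sum>j<w. out j) (S0 \<union> out ` {..<w}))"
    by (intro and_reachable_sum outs) auto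
  moreover have "hard_fun n w A B = (\<Sum>j<w. out j)"
  proof
    show "hard_fun n w A B xs = (\<Sum>j<w. out j) xs" for xs
      by (simp add: hard_fun_def out_def g_def sum_bfun_apply times_fun_apply)
  qed
  ultimately show ?thesis by (elim and_reachable_mono) auto
qed

section \<open>The lower bound\<close>

text \<open>The family has 2^(w^4 - w^3) members, while there are about (24 L)^L functions of total complexity
  at most L, and log L is at most 4 log w in the relevant range.\<close>

definition complexity_bound :: "nat \<Rightarrow> nat" where
  "complexity_bound w = nat \<lfloor>(real w ^ 4 - real w ^ 3) / (4 * log 2 w + 6)\<rfloor>"

lemma complexity_bound_bounds:
  assumes "w \<ge> 2"
  shows "(real w ^ 4 - real w ^ 3) / (4 * log 2 w + 6) - 1 \<le> complexity_bound w"
    "complexity_bound w \<le> (real w ^ 4 - real w ^ 3) / (4 * log 2 w + 6)"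
proof -
  have "real w ^ 3 \<le> real w ^ 4" using assms by (intro power_increasing) auto
  moreover have "4 * log 2 w + 6 \<ge> 0" using assms by (intro add_nonneg_nonneg) auto
  ultimately have "(real w ^ 4 - real w ^ 3) / (4 * log 2 w + 6) \<ge> 0" by (intro divide_nonneg_nonneg) auto
  then show "(real w ^ 4 - real w ^ 3) / (4 * log 2 w + 6) - 1 \<le> complexity_bound w"
    "complexity_bound w \<le> (real w ^ 4 - real w ^ 3) / (4 * log 2 w + 6)"
    unfolding complexity_bound_def by linarith+
qed

lemma eventually_complexity_bound_ge:
  assumes "\<forall>\<^sub>F w in sequentially. g w \<le> (real w ^ 4 - real w ^ 3) / (4 * log 2 w + 6) - 1"
  shows "\<forall>\<^sub>F w in sequentially. g w \<le> complexity_bound w"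
  using assms eventually_ge_at_top[of 2]
  by eventually_elim (use complexity_bound_bounds(1) in force)

text \<open>With log L \<le> 4 log w and log 24 \<le> 5, the logarithm of the count is at most L (4
  log w + 5) + 2 + 8 log w. One further L, which raises the 5 to the 6 in
  \<open>complexity_bound\<close>, exceeds the last two summands by the assumption
  \<open>big\<close>.\<close>

lemma few_cheap_funs:
  assumes w: "w \<ge> 2" and L: "L = complexity_bound w" and n: "n + 1 \<le> L" and big: "3 + 8 * log 2 w \<le> L"
  shows "card (cheap_funs n L) < 2 ^ (w ^ 3 * (w - 1))"
proof -
  have L1: "L \<ge> 1" using n by simp
  have lw: "log 2 w \<ge> 0" using w by simp
  have Lw: "real L \<le> (real w ^ 4 - real w ^ 3) / (4 * log 2 w + 6)"
    unfolding L by (rule complexity_bound_bounds(2)[OF w])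
  have "real L \<le> real w ^ 4 - real w ^ 3"
  proof -
    have "real L * 1 \<le> real L * (4 * log 2 w + 6)" using lw by (intro mult_left_mono) auto
    also have "\<dots> \<le> real w ^ 4 - real w ^ 3" using Lw lw by (simp add: pos_le_divide_eq)
    finally show ?thesis by simp
  qed
  then have "real L \<le> real w ^ 4" by (smt (verit) zero_le_power of_nat_0_le_iff)
  then have "log 2 L \<le> log 2 (real w ^ 4)" using L1 w by (subst log_le_cancel_iff) auto
  also have "\<dots> = 4 * log 2 w" using w by (simp add: log_nat_power)
  finally have logL: "log 2 L \<le> 4 * log 2 w" .
  have "log 2 24 \<le> log 2 ((2::real) ^ 5)" by (subst log_le_cancel_iff) auto
  also have "\<dots> = 5" by (subst log_nat_power) auto
  finally have log24: "log 2 (24::real) \<le> 5" .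
  have log4: "log 2 (4::real) = 2" using log_nat_power[of 2 2 2] by simp
  have pos: "4 * real L ^ 2 * (24 * real L) ^ L > 0" using L1 by simp
  have "log 2 (4 * real L ^ 2 * (24 * real L) ^ L) = 2 + 2 * log 2 L + real L * (log 2 24 + log 2 L)"
    using L1 log4 by (simp add: log_mult log_nat_power distrib_left)
  also have "\<dots> \<le> 2 + 2 * (4 * log 2 w) + real L * (5 + 4 * log 2 w)"
    using logL log24 by (intro add_mono mult_left_mono) auto
  also have "\<dots> < real L * (4 * log 2 w + 6)"
    using big by (simp add: algebra_simps)
  also have "\<dots> \<le> real w ^ 4 - real w ^ 3" using Lw lw by (simp add: pos_le_divide_eq)
  also have "\<dots> = real (w ^ 3 * (w - 1))" using w by (simp add: of_nat_diff algebra_simps power_Suc[symmetric] del: power_Suc)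
  finally have "4 * real L ^ 2 * (24 * real L) ^ L < 2 powr real (w ^ 3 * (w - 1))"
    using pos by (simp add: log_less_iff)
  with card_cheap_funs(2)[OF n] have "real (card (cheap_funs n L)) < real (2 ^ (w ^ 3 * (w - 1)))"
    unfolding of_nat_power of_nat_numeral
    using powr_realpow[of "2::real" "w ^ 3 * (w - 1)"] by linarith
  then show ?thesis by (simp only: of_nat_less_iff)
qed

lemma exists_expensive_hard_fun:
  assumes "w \<ge> 2" "L = complexity_bound w" "n + 1 \<le> L" "3 + 8 * log 2 w \<le> L" "4 * w \<le> n"
  shows "\<exists>A B. hard_fun n w A B \<notin> cheap_funs n L"
proof (rule ccontr)
  assume "\<not> ?thesis"
  then have "(\<lambda>(A, B). hard_fun n w A B) ` (Pow (parameters w) \<times> Pow (parameters w)) \<subseteq> cheap_funs n L"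
    by auto
  from card_inj_on_le[OF inj_on_hard_fun[OF assms(5)] this card_cheap_funs(1)[OF assms(3)]]
  have "2 ^ (2 * card (parameters w)) \<le> card (cheap_funs n L)"
    by (simp add: card_cartesian_product card_Pow mult_2 power_add)
  with few_cheap_funs[OF assms(1-4)] show False by (simp add: card_parameters)
qed

section \<open>Linear growth of the multiplicative complexity\<close>

lemma mult_complexity_circuit:
  assumes "\<exists>C. wf_circuit n C \<and> implements n C f"
  obtains C where "wf_circuit n C" "implements n C f" "mult_compl C = mult_complexity n f"
  using LeastI_ex[of "\<lambda>m. \<exists>C. wf_circuit n C \<and> implements n C f \<and> mult_compl C = m"] assms
  unfolding mult_complexity_def by blast

lemma mult_complexity_le:
  assumes "wf_circuit n C" "implements n C f"
  shows "mult_complexity n f \<le> mult_compl C"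
  unfolding mult_complexity_def using assms by (intro Least_le) blast

text \<open>Pad the circuit to n conjunctions and apply the upper bound.\<close>

lemma total_complexity_if_mult_complexity_less:
  assumes C: "\<exists>C. wf_circuit n C \<and> implements n C f" and less: "mult_complexity n f < n"
    and n: "n \<ge> 2" and eps: "upper_eps 3 n \<le> 1 / 2"
  shows "\<exists>C. wf_circuit n C \<and> implements n C f \<and> total_compl C \<le> 3 * n\<^sup>2"
proof -
  from C obtain C where C: "wf_circuit n C" "implements n C f" "mult_compl C = mult_complexity n f"
    by (rule mult_complexity_circuit)
  define d where "d = n - mult_complexity n f"
  from computes_pad_and[OF circuit_computes[OF C(1)], of d] obtain S where
    "node_funs n C \<subseteq> S" "computes n S (length C + d) (mult_compl C + d)" by blast
  moreover have "mult_compl C + d = n" using less C(3) by (simp add: d_def)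
  ultimately have "\<exists>S. computes n S (length C + d) n \<and> bfun_of n f \<in> S"
    using C(2) implements_iff by auto
  then obtain C1 where C1: "wf_circuit n C1" "implements n C1 f" "mult_compl C1 = n"
    using circuit_iff_computes by metis
  \<comment> \<open>The upper bound is applied with M = n and c = 1, whence
    \<open>upper_eps 3\<close>. The factor in front is at most 1 and log n at least 1, which leaves
    n (n + 2 n) gates.\<close>
  have "\<exists>C'. wf_circuit n C' \<and> implements n C' f \<and> real (total_compl C') \<le>
      (1/2 + upper_eps (2 + 1 / 1) n) * (real n * (real n + 2 * real n)) / log 2 (real n)"
    by (rule total_complexity_asymptotic_upper[OF _ C1]) (use n in auto)
  then obtain C' where C': "wf_circuit n C'" "implements n C' f"
    "real (total_compl C') \<le> (1/2 + upper_eps 3 n) * (real n * (real n + 2 * real n)) / log 2 (real n)"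
    by auto
  note C'(3)
  also have "(1/2 + upper_eps 3 n) * (real n * (real n + 2 * real n)) / log 2 (real n) \<le>
      1 * (real n * (real n + 2 * real n)) / 1"
    using eps n by (intro frac_le mult_right_mono) auto
  also have "\<dots> = real (3 * n\<^sup>2)" by (simp add: power2_eq_square)
  finally show ?thesis using C' by (simp only: of_nat_le_iff) blast
qed

text \<open>ln x / x decreases beyond e, and 3 is a convenient number above e. This allows the
  unknown multiplicative complexity to be replaced by its upper bound.\<close>

lemma div_log_mono:
  assumes "3 \<le> x" "x \<le> (y::real)"
  shows "x / log 2 x \<le> y / log 2 y"
proof -
  have "exp 1 \<le> x" using exp_le assms(1) by linarith
  from ln_x_over_x_mono[OF this assms(2)] have "ln y / y \<le> ln x / x" .
  moreover have "ln x > 0" "ln y > 0" using assms by simp_all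
  ultimately have "x / ln x \<le> y / ln y" using assms by (simp add: field_simps)
  from mult_right_mono[OF this, of "ln 2"] show ?thesis by (simp add: log_def)
qed

lemma filterlim_div_4: "filterlim (\<lambda>n::nat. n div 4) at_top sequentially"
  unfolding filterlim_at_top
proof
  fix Z :: nat
  show "\<forall>\<^sub>F n in sequentially. Z \<le> n div 4"
    using eventually_ge_at_top[of "4 * Z"] by eventually_elim auto
qed

text \<open>The guaranteed total complexity relative to M (M + 2 n) / log M at the largest possible
  values M = w^2 + w and n = 4 w + 3, for which M + 2 n = w^2 + 9 w + 6.\<close>

definition limit_ratio :: "nat \<Rightarrow> real" where
  "limit_ratio w = complexity_bound w /
     ((real w ^ 2 + real w) * (real w ^ 2 + 9 * real w + 6) / log 2 (real w ^ 2 + real w))"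

text \<open>The numerator is about w^4 / (4 log w) and the denominator about w^4 / (2 log w),
  because log (w^2 + w) is about 2 log w.\<close>

lemma limit_ratio_tendsto: "limit_ratio \<longlonglongrightarrow> 1 / 2"
proof (rule tendsto_sandwich)
  let ?R = "\<lambda>w::nat. (real w ^ 4 - real w ^ 3) / (4 * log 2 w + 6)"
  let ?T = "\<lambda>w::nat. (real w ^ 2 + real w) * (real w ^ 2 + 9 * real w + 6) / log 2 (real w ^ 2 + real w)"
  have T: "?T w \<ge> 0" if "w \<ge> 2" for w
  proof -
    have "log 2 (real w ^ 2 + real w) \<ge> 0" using that
      by (subst zero_le_log_cancel_iff) (auto intro: add_pos_nonneg add_increasing)
    then show ?thesis by (intro divide_nonneg_nonneg) auto
  qed
  show "\<forall>\<^sub>F w in sequentially. (?R w - 1) / ?T w \<le> limit_ratio w"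
    using eventually_ge_at_top[of 2] unfolding limit_ratio_def
    by eventually_elim (intro divide_right_mono complexity_bound_bounds T, auto)
  show "\<forall>\<^sub>F w in sequentially. limit_ratio w \<le> ?R w / ?T w"
    using eventually_ge_at_top[of 2] unfolding limit_ratio_def
    by eventually_elim (intro divide_right_mono complexity_bound_bounds T, auto)
  show "(\<lambda>w. (?R w - 1) / ?T w) \<longlonglongrightarrow> 1 / 2" by real_asymp
  show "(\<lambda>w. ?R w / ?T w) \<longlonglongrightarrow> 1 / 2" by real_asymp
qed

lemma hard_fun_wrong_length: "length xs \<noteq> n \<Longrightarrow> hard_fun n w A B xs = 0"
  by (simp add: hard_fun_def source_def bfun_of_def)

lemma bfun_of_hard_fun: "bfun_of n (\<lambda>xs. hard_fun n w A B xs = 1) = hard_fun n w A B"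
proof
  fix xs
  have "of_bool (z = 1) = z" for z :: bit by (cases z) auto
  then show "bfun_of n (\<lambda>xs. hard_fun n w A B xs = 1) xs = hard_fun n w A B xs"
    by (simp add: bfun_of_def hard_fun_wrong_length)
qed

lemma hard_fun_circuit:
  assumes "4 * w \<le> n"
  shows "\<exists>C. wf_circuit n C \<and> implements n C (\<lambda>xs. hard_fun n w A B xs = 1) \<and> mult_compl C \<le> w * w + w"
proof -
  from and_reachable_hard_fun[OF assms, of A B] obtain S k m where
    "computes n S k m" "m \<le> w * w + w" "hard_fun n w A B \<in> S"
    unfolding and_reachable_def reachable_def by blast
  with circuit_iff_computes[of n "\<lambda>xs. hard_fun n w A B xs = 1" m k] bfun_of_hard_fun[of n w A B] show ?thesis by metis
qed

lemma hard_fun_total_compl: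
  assumes "hard_fun n w A B \<notin> cheap_funs n L" "wf_circuit n C" "implements n C (\<lambda>xs. hard_fun n w A B xs = 1)"
  shows "L < total_compl C"
proof (rule ccontr)
  assume "\<not> L < total_compl C"
  then have "length C \<le> L" by (simp add: total_compl_def)
  moreover have "hard_fun n w A B \<in> node_funs n C"
    using assms(3) unfolding implements_iff bfun_of_hard_fun .
  ultimately have "hard_fun n w A B \<in> cheap_funs n L"
    using circuit_computes[OF assms(2)] unfolding cheap_funs_def by blast
  with assms(1) show False ..
qed

lemma lower_bound_family:
  "\<exists>F :: nat \<Rightarrow> (bool list \<Rightarrow> bool). (\<forall>n. \<exists>C. wf_circuit n C \<and> implements n C (F n)) \<and>
     (\<forall>n. mult_complexity n (F n) \<le> (n div 4) * (n div 4) + n div 4) \<and>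
     (\<forall>\<^sub>F n in sequentially. n \<le> mult_complexity n (F n) \<and>
        (\<forall>C. wf_circuit n C \<and> implements n C (F n) \<longrightarrow> complexity_bound (n div 4) \<le> total_compl C))"
proof -
  \<comment> \<open>For small \<open>n\<close> there may be no expensive member; \<open>SOME\<close>
    then yields arbitrary parameters, for which the bound on the conjunctions still holds.\<close>
  define p where "p = (\<lambda>n. SOME p. hard_fun n (n div 4) (fst p) (snd p) \<notin> cheap_funs n (complexity_bound (n div 4)))"
  define hf where "hf = (\<lambda>n. hard_fun n (n div 4) (fst (p n)) (snd (p n)))"
  define F where "F = (\<lambda>n xs. hf n xs = 1)"
  have circ: "\<exists>C. wf_circuit n C \<and> implements n C (F n) \<and> mult_compl C \<le> (n div 4) * (n div 4) + n div 4" for n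
    unfolding F_def hf_def by (rule hard_fun_circuit) simp
  then have mc: "mult_complexity n (F n) \<le> (n div 4) * (n div 4) + n div 4" for n
    using mult_complexity_le order.trans by metis
  \<comment> \<open>With n \<le> 4 w + 3, the first condition absorbs the polynomial factor of the
    count, the second gives n + 1 \<le> L, and the third puts L above the 3 n^2 gates that suffice
    for functions with fewer than n conjunctions.\<close>
  have "\<forall>\<^sub>F w :: nat in sequentially. 3 + 8 * log 2 w \<le> complexity_bound w"
    "\<forall>\<^sub>F w :: nat in sequentially. 4 * real w + 4 \<le> complexity_bound w"
    "\<forall>\<^sub>F w :: nat in sequentially. 3 * (4 * real w + 3)\<^sup>2 \<le> complexity_bound w"
    by (rule eventually_complexity_bound_ge; real_asymp)+
  with eventually_ge_at_top[of "2::nat"] have "\<forall>\<^sub>F w :: nat in sequentially. w \<ge> 2 \<and> 3 + 8 * log 2 w \<le> complexity_bound w \<and>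
      4 * real w + 4 \<le> complexity_bound w \<and> 3 * (4 * real w + 3)\<^sup>2 \<le> complexity_bound w"
    by eventually_elim auto
  from eventually_compose_filterlim[OF this filterlim_div_4]
  have w: "\<forall>\<^sub>F n in sequentially. n div 4 \<ge> 2 \<and> 3 + 8 * log 2 (n div 4) \<le> complexity_bound (n div 4) \<and>
      4 * real (n div 4) + 4 \<le> complexity_bound (n div 4) \<and>
      3 * (4 * real (n div 4) + 3)\<^sup>2 \<le> complexity_bound (n div 4)" .
  have eps: "\<forall>\<^sub>F n in sequentially. upper_eps 3 n < 1 / 2"
    using upper_eps_tendsto_0 by (rule order_tendstoD) simp
  from w eps have "\<forall>\<^sub>F n in sequentially. n \<le> mult_complexity n (F n) \<and>
        (\<forall>C. wf_circuit n C \<and> implements n C (F n) \<longrightarrow> complexity_bound (n div 4) \<le> total_compl C)"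
  proof eventually_elim
    case (elim n)
    define w L where "w = n div 4" and "L = complexity_bound w"
    have nw: "n \<le> 4 * w + 3" "4 * w \<le> n" by (simp_all add: w_def)
    have e: "w \<ge> 2" "3 + 8 * log 2 w \<le> L" "4 * real w + 4 \<le> L" "3 * (4 * real w + 3)\<^sup>2 \<le> L"
      using elim by (simp_all add: w_def L_def)
    have "n + 1 \<le> L" using e(3) nw(1) by linarith
    from exists_expensive_hard_fun[OF e(1) L_def this e(2) nw(2)]
    have "\<exists>p. hard_fun n w (fst p) (snd p) \<notin> cheap_funs n L" by auto
    then have "hard_fun n w (fst (p n)) (snd (p n)) \<notin> cheap_funs n L"
      unfolding p_def w_def[symmetric] L_def[symmetric] by (rule someI_ex)
    then have total: "L < total_compl C" if "wf_circuit n C" "implements n C (F n)" for C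
      using that unfolding F_def hf_def w_def[symmetric] by (rule hard_fun_total_compl)
    have "n \<le> mult_complexity n (F n)"
    proof (rule ccontr)
      assume "\<not> n \<le> mult_complexity n (F n)"
      with circ[of n] elim nw e(1) obtain C where C: "wf_circuit n C" "implements n C (F n)" "total_compl C \<le> 3 * n\<^sup>2"
        using total_complexity_if_mult_complexity_less[of n "F n"] by auto
      have "real (3 * n\<^sup>2) \<le> 3 * (4 * real w + 3)\<^sup>2"
        using nw(1) by (simp add: power_mono flip: of_nat_le_iff)
      with e(4) have "3 * n\<^sup>2 \<le> L" by linarith
      with C total[OF C(1,2)] show False by simp
    qed
    with total show ?case by (auto simp: L_def w_def less_imp_le)
  qed
  with circ mc show ?thesis by (intro exI[of _ F]) blast
qed

theorem theorem1:
  shows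
  "(\<forall>c::real. c > 0 \<longrightarrow>
      (\<exists>eps :: nat \<Rightarrow> real. eps \<longlonglongrightarrow> 0 \<and>
        (\<forall>n f C M. wf_circuit n C \<and> implements n C f \<and> mult_compl C = M \<and>
            real M \<ge> c * real n \<and> M \<ge> 2 \<longrightarrow>
          (\<exists>C'. wf_circuit n C' \<and> implements n C' f \<and>
             real (total_compl C') \<le>
               (1/2 + eps M) * (real M * (real M + 2 * real n)) / log 2 (real M)))))
   \<and>
   (\<exists>F :: nat \<Rightarrow> (bool list \<Rightarrow> bool).
      (\<forall>n. \<exists>C. wf_circuit n C \<and> implements n C (F n)) \<and>
      (\<exists>d::real. d > 0 \<and>
         (\<forall>\<^sub>F n in sequentially. real (mult_complexity n (F n)) \<ge> d * real n)) \<and>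
      (\<exists>delta :: nat \<Rightarrow> real. delta \<longlonglongrightarrow> 0 \<and>
         (\<forall>n C. wf_circuit n C \<and> implements n C (F n) \<longrightarrow>
            real (total_compl C) \<ge>
              (1/2 - delta n) * (real (mult_complexity n (F n)) *
                 (real (mult_complexity n (F n)) + 2 * real n))
                / log 2 (real (mult_complexity n (F n))))))"
proof (rule conjI)
  show "\<forall>c::real. c > 0 \<longrightarrow>
      (\<exists>eps :: nat \<Rightarrow> real. eps \<longlonglongrightarrow> 0 \<and>
        (\<forall>n f C M. wf_circuit n C \<and> implements n C f \<and> mult_compl C = M \<and>
            real M \<ge> c * real n \<and> M \<ge> 2 \<longrightarrow>
          (\<exists>C'. wf_circuit n C' \<and> implements n C' f \<and>
             real (total_compl C') \<le>
               (1/2 + eps M) * (real M * (real M + 2 * real n)) / log 2 (real M))))"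
  proof (intro allI impI)
    fix c :: real assume c: "c > 0"
    show "\<exists>eps :: nat \<Rightarrow> real. eps \<longlonglongrightarrow> 0 \<and>
        (\<forall>n f C M. wf_circuit n C \<and> implements n C f \<and> mult_compl C = M \<and>
            real M \<ge> c * real n \<and> M \<ge> 2 \<longrightarrow>
          (\<exists>C'. wf_circuit n C' \<and> implements n C' f \<and>
             real (total_compl C') \<le>
               (1/2 + eps M) * (real M * (real M + 2 * real n)) / log 2 (real M)))"
      using upper_eps_tendsto_0[of "2 + 1 / c"] total_complexity_asymptotic_upper[OF c]
      by (intro exI[of _ "upper_eps (2 + 1 / c)"] conjI allI impI) blast+
  qed
next
  obtain F :: "nat \<Rightarrow> (bool list \<Rightarrow> bool)" where
    F: "\<And>n. \<exists>C. wf_circuit n C \<and> implements n C (F n)"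
      "\<And>n. mult_complexity n (F n) \<le> (n div 4) * (n div 4) + n div 4"
    and ev: "\<forall>\<^sub>F n in sequentially. n \<le> mult_complexity n (F n) \<and>
        (\<forall>C. wf_circuit n C \<and> implements n C (F n) \<longrightarrow> complexity_bound (n div 4) \<le> total_compl C)"
    using lower_bound_family by blast
  have omega: "\<forall>\<^sub>F n in sequentially. real (mult_complexity n (F n)) \<ge> 1 * real n"
    using ev by eventually_elim simp
  from eventually_conj[OF ev eventually_ge_at_top[of 8]] obtain n0 where n0: "\<And>n. n \<ge> n0 \<Longrightarrow>
      n \<le> mult_complexity n (F n) \<and>
      (\<forall>C. wf_circuit n C \<and> implements n C (F n) \<longrightarrow> complexity_bound (n div 4) \<le> total_compl C) \<and> n \<ge> 8"
    unfolding eventually_sequentially by blast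
  \<comment> \<open>Below \<open>n0\<close> the value 1/2 makes the claimed bound 0, so that the
    inequality holds for every \<open>n\<close>.\<close>
  define delta where "delta = (\<lambda>n. if n < n0 then 1 / 2 else \<bar>1 / 2 - limit_ratio (n div 4)\<bar>)"
  from filterlim_compose[OF limit_ratio_tendsto filterlim_div_4]
  have "(\<lambda>n. limit_ratio (n div 4)) \<longlonglongrightarrow> 1 / 2" .
  then have "(\<lambda>n. \<bar>1 / 2 - limit_ratio (n div 4)\<bar>) \<longlonglongrightarrow> \<bar>1 / 2 - 1 / 2\<bar>"
    by (intro tendsto_intros)
  moreover have "\<forall>\<^sub>F n in sequentially. \<bar>1 / 2 - limit_ratio (n div 4)\<bar> = delta n"
    using eventually_ge_at_top[of n0] by eventually_elim (simp add: delta_def)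
  ultimately have delta: "delta \<longlonglongrightarrow> 0"
    by (simp add: tendsto_cong)
  have bound: "real (total_compl C) \<ge> (1/2 - delta n) * (real (mult_complexity n (F n)) *
        (real (mult_complexity n (F n)) + 2 * real n)) / log 2 (real (mult_complexity n (F n)))"
    if C: "wf_circuit n C" "implements n C (F n)" for n C
  proof (cases "n < n0")
    case True
    then show ?thesis by (simp add: delta_def)
  next
    case False
    define w m \<mu> where "w = n div 4" and "m = real w ^ 2 + real w" and "\<mu> = real (mult_complexity n (F n))"
    define T where "T = m * (real w ^ 2 + 9 * real w + 6) / log 2 m"
    from n0[of n] False have n8: "n \<ge> 8" and "n \<le> mult_complexity n (F n)"
      and tot: "complexity_bound w \<le> total_compl C" using C by (auto simp: w_def)
    then have \<mu>n: "real n \<le> \<mu>" by (simp add: \<mu>_def)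
    have "\<mu> \<le> real (w * w + w)" using F(2)[of n] unfolding \<mu>_def w_def by (simp only: of_nat_le_iff)
    then have \<mu>m: "\<mu> \<le> m" by (simp add: m_def power2_eq_square)
    have \<mu>3: "3 \<le> \<mu>" using n8 \<mu>n by linarith
    have "n \<le> 4 * w + 3" by (simp add: w_def)
    then have nw: "real n \<le> 4 * real w + 3" by linarith
    have logs: "log 2 \<mu> > 0" "log 2 m > 0" using \<mu>3 \<mu>m by simp_all
    \<comment> \<open>Only an upper bound \<open>m\<close> for \<mu> is known, but the expression
      grows with \<mu> and \<open>n\<close>, so its value at \<open>m\<close> and 4 w + 3 dominates.
      Having n \<ge> 8 places \<mu> where x / log x increases.\<close>
    have "\<mu> * (\<mu> + 2 * real n) / log 2 \<mu> = (\<mu> / log 2 \<mu>) * (\<mu> + 2 * real n)" by simp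
    also have "\<dots> \<le> (m / log 2 m) * (real w ^ 2 + 9 * real w + 6)"
      using \<mu>3 \<mu>m nw logs by (intro mult_mono div_log_mono) (auto simp: m_def)
    also have "\<dots> = T" by (simp add: T_def)
    finally have le: "\<mu> * (\<mu> + 2 * real n) / log 2 \<mu> \<le> T" .
    have nonneg: "\<mu> * (\<mu> + 2 * real n) / log 2 \<mu> \<ge> 0" using \<mu>3 logs by (intro divide_nonneg_pos) auto
    have "T > 0" unfolding T_def using \<mu>3 \<mu>m logs
      by (intro divide_pos_pos mult_pos_pos) (auto intro: add_nonneg_pos)
    have ratio: "limit_ratio w = complexity_bound w / T" by (simp add: limit_ratio_def T_def m_def)
    have "1/2 - delta n \<le> limit_ratio w" using False by (simp add: delta_def w_def)
    then have "(1/2 - delta n) * (\<mu> * (\<mu> + 2 * real n) / log 2 \<mu>) \<le>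
        limit_ratio w * (\<mu> * (\<mu> + 2 * real n) / log 2 \<mu>)"
      using nonneg by (rule mult_right_mono)
    also have "\<dots> \<le> limit_ratio w * T"
      using le \<open>T > 0\<close> by (intro mult_left_mono) (simp_all add: ratio)
    also have "\<dots> = complexity_bound w" using \<open>T > 0\<close> by (simp add: ratio)
    also have "\<dots> \<le> total_compl C" using tot by simp
    finally show ?thesis by (simp add: \<mu>_def)
  qed
  show "\<exists>F :: nat \<Rightarrow> (bool list \<Rightarrow> bool).
      (\<forall>n. \<exists>C. wf_circuit n C \<and> implements n C (F n)) \<and>
      (\<exists>d::real. d > 0 \<and>
         (\<forall>\<^sub>F n in sequentially. real (mult_complexity n (F n)) \<ge> d * real n)) \<and>
      (\<exists>delta :: nat \<Rightarrow> real. delta \<longlonglongrightarrow> 0 \<and>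
         (\<forall>n C. wf_circuit n C \<and> implements n C (F n) \<longrightarrow>
            real (total_compl C) \<ge>
              (1/2 - delta n) * (real (mult_complexity n (F n)) *
                 (real (mult_complexity n (F n)) + 2 * real n))
                / log 2 (real (mult_complexity n (F n)))))"
    by (intro exI[of _ F] conjI exI[of _ "1::real"] exI[of _ delta] allI impI)
      (use F(1) omega delta bound in auto)
qed

end
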